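(* Let $d\ge2$ and let $P=\{p_1,\ldots,p_d\}$, $Q=\{q_1,\ldots,q_d\}$ be posets. The following are equivalent: (i) $\Gamma(\mathcal{C}(P),-\mathcal{C}(Q))$ is $\mathbb{Q}$-factorial; (ii) $\Gamma(\mathcal{C}(P),-\mathcal{C}(Q))$ is smooth; (iii) $\Gamma(\mathcal{C}(P),-\mathcal{C}(Q))$ splits into copies of the closed interval $[-1,1]$, of the del Pezzo $2$-polytope $V_2$, or of the pseudo del Pezzo $2$-polytope $\tilde V_2$; (iv) any two distinct $2$-element antichains of $P$ are disjoint, any two distinct $2$-element antichains of $Q$ are disjoint, and for every $2$-element antichain $\{p_a,p_b\}$ of $P$ and every $2$-element antichain $\{q_c,q_e\}$ of $Q$ we have $|\{a,b\}\cap\{c,e\}|\ne1$.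
   Context: For $S\subset P$ (resp. $Q$), $\rho(S)=\sum_{p_i\in S}\mathbf{e}_i$ (resp. $\sum_{q_i\in S}\mathbf{e}_i$). $\Gamma(\mathcal{C}(P),-\mathcal{C}(Q))$ is the convex hull in $\mathbb{R}^d$ of $\{\rho(A):A\text{ antichain of }P\}\cup\{-\rho(B):B\text{ antichain of }Q\}$; it is a $d$-dimensional Fano polytope (the origin is its unique interior lattice point). A Fano polytope is $\mathbb{Q}$-factorial if it is simplicial, and smooth if the vertices of each facet form a $\mathbb{Z}$-basis of $\mathbb{Z}^d$. $V_2=\mathrm{conv}(\pm\mathbf{e}_1,\pm\mathbf{e}_2,\pm(\mathbf{e}_1+\mathbf{e}_2))\subset\mathbb{R}^2$, $\tilde V_2=\mathrm{conv}(\pm\mathbf{e}_1,\pm\mathbf{e}_2,\mathbf{e}_1+\mathbf{e}_2)$. A Fano polytope $\mathcal{P}\subset\mathbb{R}^d$ splits into Fano polytopes $\mathcal{P}_1\subset\mathbb{R}^{d_1}$, $\mathcal{P}_2\subset\mathbb{R}^{d_2}$ ($d=d_1+d_2$) if, after renumbering coordinates, $\mathcal{P}=\mathrm{conv}(\{(\alpha_1,0),(0,\alpha_2):\alpha_1\in\mathcal{P}_1,\alpha_2\in\mathcal{P}_2\})$; iterating gives splitting into several pieces. "Copies" are understood up to unimodular linear transformation. *)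

theory Defs
  imports "HOL-Analysis.Analysis"
begin

text \<open>
  A poset $\{p_1,\ldots,p_d\}$ is a carrier with a partial order together with a bijection from the
  coordinate type of \<open>real^'n\<close> (so $d$ is the cardinality of \<open>'n\<close>) onto the carrier.
\<close>

definition antichain :: "'a set \<Rightarrow> 'a rel \<Rightarrow> 'a set \<Rightarrow> bool" where
  "antichain P r A \<longleftrightarrow> A \<subseteq> P \<and> (\<forall>x\<in>A. \<forall>y\<in>A. x \<noteq> y \<longrightarrow> (x, y) \<notin> r)"

definition rho :: "('n::finite \<Rightarrow> 'a) \<Rightarrow> 'a set \<Rightarrow> real^'n" where
  "rho p S = (\<Sum>i | p i \<in> S. axis i 1)"

definition Gamma_polytope ::
  "'a set \<Rightarrow> 'a rel \<Rightarrow> ('n::finite \<Rightarrow> 'a) \<Rightarrow> 'b set \<Rightarrow> 'b rel \<Rightarrow> ('n \<Rightarrow> 'b) \<Rightarrow> (real^'n) set" where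
  "Gamma_polytope P r p Q s q =
     convex hull ({rho p A |A. antichain P r A} \<union> {- rho q B |B. antichain Q s B})"

definition int_lattice :: "(real^'n::finite) set" where
  "int_lattice = {x. \<forall>i. x $ i \<in> \<int>}"

text \<open>
  For a set \<open>I\<close> of coordinates, the space $\mathbb{R}^{|I|}$ is represented by the coordinate
  subspace of vectors supported in \<open>I\<close>. This makes it possible to speak about the pieces of a
  splitting, which live in dimensions that vary inside the statement.
\<close>

definition coord_space :: "'n set \<Rightarrow> (real^'n::finite) set" where
  "coord_space I = {x. \<forall>i. i \<notin> I \<longrightarrow> x $ i = 0}"

text \<open>
  Since \<open>X\<close> has affine hull \<open>coord_space I\<close>, its relative interior is its interior in
  $\mathbb{R}^{|I|}$; for \<open>I = UNIV\<close> it is the ordinary interior.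
\<close>

definition fano_in :: "'n set \<Rightarrow> (real^'n::finite) set \<Rightarrow> bool" where
  "fano_in I X \<longleftrightarrow>
     polytope X \<and> (\<forall>v. v extreme_point_of X \<longrightarrow> v \<in> int_lattice) \<and>
     affine hull X = coord_space I \<and> rel_interior X \<inter> int_lattice = {0}"

definition simplicial :: "'a::euclidean_space set \<Rightarrow> bool" where
  "simplicial X \<longleftrightarrow> (\<forall>F. F facet_of X \<longrightarrow> (\<exists>k. k simplex F))"

interpretation int_module: module "\<lambda>(k::int) (v::real^'n::finite). of_int k *\<^sub>R v"
  by unfold_locales (simp_all add: algebra_simps)

definition lattice_basis :: "(real^'n::finite) set \<Rightarrow> bool" where
  "lattice_basis B \<longleftrightarrow> \<not> int_module.dependent B \<and> int_module.span B = int_lattice"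

definition Q_factorial_fano :: "(real^'n::finite) set \<Rightarrow> bool" where
  "Q_factorial_fano X \<longleftrightarrow> fano_in UNIV X \<and> simplicial X"

definition smooth_fano :: "(real^'n::finite) set \<Rightarrow> bool" where
  "smooth_fano X \<longleftrightarrow>
     fano_in UNIV X \<and> (\<forall>F. F facet_of X \<longrightarrow> lattice_basis {v. v extreme_point_of F})"

definition symmetric_interval :: "(real^1) set" where
  "symmetric_interval = {x. -1 \<le> x $ 1 \<and> x $ 1 \<le> 1}"

definition del_Pezzo :: "(real^2) set" where
  "del_Pezzo = convex hull
     {axis 1 1, - axis 1 1, axis 2 1, - axis 2 1, axis 1 1 + axis 2 1, - (axis 1 1 + axis 2 1)}"

definition pseudo_del_Pezzo :: "(real^2) set" where
  "pseudo_del_Pezzo = convex hull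
     {axis 1 1, - axis 1 1, axis 2 1, - axis 2 1, axis 1 1 + axis 2 1}"

definition unimodular :: "real^'m^'m::finite \<Rightarrow> bool" where
  "unimodular U \<longleftrightarrow> (\<forall>i j. U $ i $ j \<in> \<int>) \<and> \<bar>det U\<bar> = 1"

text \<open>
  \<open>X\<close> is the image of \<open>V\<close> under a unimodular map, placed in the coordinates
  \<open>I\<close> by means of a numbering of \<open>I\<close>.
\<close>

definition copy_in :: "(real^'m::finite) set \<Rightarrow> 'n set \<Rightarrow> (real^'n::finite) set \<Rightarrow> bool" where
  "copy_in V I X \<longleftrightarrow>
     (\<exists>\<sigma> U. bij_betw \<sigma> UNIV I \<and> unimodular U \<and>
        X = (\<lambda>v. \<Sum>j\<in>UNIV. (U *v v) $ j *\<^sub>R axis (\<sigma> j) 1) ` V)"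

text \<open>
  One splitting step. The renumbering of coordinates is the choice of the two complementary
  blocks \<open>I1\<close> and \<open>I2\<close> of \<open>I\<close>.
\<close>

definition splits ::
  "'n set \<Rightarrow> (real^'n::finite) set \<Rightarrow> 'n set \<Rightarrow> (real^'n) set \<Rightarrow> 'n set \<Rightarrow> (real^'n) set \<Rightarrow> bool" where
  "splits I X I1 X1 I2 X2 \<longleftrightarrow>
     I1 \<noteq> {} \<and> I2 \<noteq> {} \<and> I1 \<inter> I2 = {} \<and> I1 \<union> I2 = I \<and>
     fano_in I X \<and> fano_in I1 X1 \<and> fano_in I2 X2 \<and> X = convex hull (X1 \<union> X2)"

text \<open>
  Iterated splitting into pieces satisfying \<open>K\<close>. A polytope that itself satisfies
  \<open>K\<close> counts as split into one piece; this is needed already for $d = 2$, where neither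
  $V_2$ nor $\tilde V_2$ splits any further.
\<close>

inductive splits_into ::
  "('n set \<Rightarrow> (real^'n::finite) set \<Rightarrow> bool) \<Rightarrow> 'n set \<Rightarrow> (real^'n) set \<Rightarrow> bool"
  for K where
  piece: "fano_in I X \<Longrightarrow> K I X \<Longrightarrow> splits_into K I X"
| split: "splits I X I1 X1 I2 X2 \<Longrightarrow> splits_into K I1 X1 \<Longrightarrow> splits_into K I2 X2 \<Longrightarrow>
    splits_into K I X"

end

theory Submission
  imports Defs
begin

text \<open>
  The posets matter only through their incomparability graphs $G$ and $H$ on the coordinates:
  antichains are cliques, and condition (iv) says that $G \cup H$ is a matching.

  If $G \cup H$ is not a matching, some proper face contains four vertices with $u + z = v + w$, so
  a facet through that face is neither a simplex nor has lattice-independent vertices. If it is a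
  matching, every clique has at most two elements and lies in one block of the matching, so the
  polytope is the free sum of its parts over the blocks, which are intervals, hexagons $V_2$ or
  pentagons $\tilde V_2$. Finally, for these pieces the vertices on any supporting
  hyperplane $f = 1$ extend to a lattice basis; this property passes to free sums, and for a
  facet the vertices must already be the whole basis, by dimension.
\<close>

text \<open>All polytopes built from the graphs have the form
  \<open>convex hull (clique_points G H \<inter> coord_space J)\<close>, and each of them is Fano
  whatever the graphs are: the generators have entries -1, 0, 1 and include the signed unit vectors
  of \<open>J\<close>. Hence only the facets carry information, and the Fano conditions on the
  pieces come for free when a splitting is constructed. One obstruction serves both conditions on
  facets, since u + z - v - w = 0 has integer coefficients whose sum is zero: it is an integral
  linear dependence and an affine one. The four points must be vertices and not merely generators,
  because a simplex contains many non-vertices in such relations; this is why every nonempty clique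
  is first shown to give a vertex. No facet is ever computed. A relation on a proper face persists
  on any facet containing it, so it is enough to find a functional that is at most 1 on all
  generators and equal to 1 on the four vertices.\<close>

section \<open>Unimodularity of supporting hyperplanes\<close>

text \<open>
  For \<open>I = UNIV\<close> these are the lattice bases: spanning sets of at most the right size are
  independent.
\<close>

definition lattice_frame :: "'n set \<Rightarrow> (real^'n::finite) set \<Rightarrow> bool" where
  "lattice_frame I C \<longleftrightarrow> finite C \<and> card C \<le> card I \<and> C \<subseteq> int_lattice \<and>
     (\<forall>i\<in>I. axis i 1 \<in> int_module.span C)"

text \<open>
  Quantifying over all supporting functionals, and not only over those defining facets, makes this
  property stable under free sums without any description of the facets of a free sum.
\<close>

definition unimodular_hull :: "'n set \<Rightarrow> (real^'n::finite) set \<Rightarrow> bool" where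
  "unimodular_hull I X \<longleftrightarrow>
     (\<exists>V. finite V \<and> X = convex hull V \<and>
       (\<forall>a. (\<forall>v\<in>V. a \<bullet> v \<le> 1) \<longrightarrow> (\<exists>C. lattice_frame I C \<and> {v \<in> V. a \<bullet> v = 1} \<subseteq> C)))"

lemma int_lattice_subspace: "int_module.subspace int_lattice"
  by (auto simp: int_module.subspace_def int_lattice_def)

lemma int_span_subset_span: "int_module.span C \<subseteq> span C"
  by (rule int_module.span_minimal)
    (auto simp: int_module.subspace_def span_superset span_zero span_add span_scale)

lemma int_lattice_subset_axis_span:
  assumes "\<And>i. axis i 1 \<in> int_module.span C"
  shows "int_lattice \<subseteq> int_module.span (C :: (real^'n::finite) set)"
proof
  fix x :: "real^'n"
  assume x: "x \<in> int_lattice"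
  then have "\<forall>i. \<exists>k. x $ i = of_int k"
    by (auto simp: int_lattice_def elim: Ints_cases)
  then obtain k where k: "\<And>i. x $ i = of_int (k i)"
    by metis
  have "x = (\<Sum>i\<in>UNIV. of_int (k i) *\<^sub>R axis i 1)"
    by (simp add: vec_eq_iff k axis_def if_distrib cong: if_cong)
  also have "\<dots> \<in> int_module.span C"
    by (intro int_module.span_sum int_module.span_scale assms)
  finally show "x \<in> int_module.span C" .
qed

lemma lattice_frame_independent:
  assumes "lattice_frame UNIV (C :: (real^'n::finite) set)"
  shows "independent C" and "card C = CARD('n)"
proof -
  have fin: "finite C" and card: "card C \<le> CARD('n)" and ax: "\<And>i. axis i 1 \<in> span C"
    using assms int_span_subset_span unfolding lattice_frame_def by auto
  have "(UNIV :: (real^'n) set) \<subseteq> span C"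
  proof
    fix x :: "real^'n"
    have "x = (\<Sum>i\<in>UNIV. x $ i *\<^sub>R axis i 1)"
      by (simp add: vec_eq_iff axis_def if_distrib cong: if_cong)
    also have "\<dots> \<in> span C"
      by (intro span_sum span_scale ax)
    finally show "x \<in> span C" .
  qed
  then show ind: "independent C"
    using card_le_dim_spanning[of C UNIV] fin card by (simp add: dim_UNIV)
  then show "card C = CARD('n)"
    using dim_eq_card_independent[of C] dim_subset[of UNIV "span C"] \<open>UNIV \<subseteq> span C\<close> card
    by (simp add: dim_UNIV)
qed

lemma independent_imp_int_independent:
  assumes "independent (C :: (real^'n::finite) set)"
  shows "\<not> int_module.dependent C"
  unfolding int_module.dependent_explicit
proof
  assume "\<exists>t u. finite t \<and> t \<subseteq> C \<and> (\<Sum>v\<in>t. of_int (u v) *\<^sub>R v) = 0 \<and> (\<exists>v\<in>t. u v \<noteq> 0)"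
  then obtain t u v where "finite t" "t \<subseteq> C" "(\<Sum>v\<in>t. of_int (u v) *\<^sub>R v) = 0" "v \<in> t" "u v \<noteq> (0 :: int)"
    by blast
  then show False
    using independentD[OF assms, of t "\<lambda>v. of_int (u v)" v] by simp
qed

lemma lattice_frame_basis:
  assumes "lattice_frame UNIV (C :: (real^'n::finite) set)"
  shows "lattice_basis C"
  unfolding lattice_basis_def
proof
  show "\<not> int_module.dependent C"
    using assms lattice_frame_independent(1) independent_imp_int_independent by blast
  show "int_module.span C = int_lattice"
  proof
    show "int_module.span C \<subseteq> int_lattice"
      using assms by (intro int_module.span_minimal int_lattice_subspace) (simp add: lattice_frame_def)
    show "int_lattice \<subseteq> int_module.span C"
      using assms by (intro int_lattice_subset_axis_span) (simp add: lattice_frame_def)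
  qed
qed

text \<open>An upper bound on the size is convenient here: the sizes of \<open>C\<close> and
  \<open>D\<close> add up to at most \<open>card I + card J\<close>, which is
  \<open>card (I \<union> J)\<close> because the blocks are disjoint.\<close>

lemma lattice_frame_Un:
  assumes "lattice_frame I C" and "lattice_frame J D" and "I \<inter> J = {}"
  shows "lattice_frame (I \<union> J) (C \<union> (D :: (real^'n::finite) set))"
proof -
  have "card (C \<union> D) \<le> card (I \<union> J)"
    using assms card_Un_le[of C D] by (simp add: lattice_frame_def card_Un_disjoint)
  moreover have "int_module.span C \<subseteq> int_module.span (C \<union> D)" "int_module.span D \<subseteq> int_module.span (C \<union> D)"
    by (auto intro: int_module.span_mono[THEN subsetD])
  ultimately show ?thesis
    using assms unfolding lattice_frame_def by auto
qed

text \<open>A functional bounded by 1 on \<open>V \<union> W\<close> is bounded by 1 on each part,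
  and its points of value 1 are those of \<open>V\<close> together with those of \<open>W\<close>;
  one frame for each part gives a frame for the union.\<close>

lemma unimodular_hull_Un:
  assumes "unimodular_hull I X" and "unimodular_hull J Y" and "I \<inter> J = {}"
  shows "unimodular_hull (I \<union> J) (convex hull (X \<union> (Y :: (real^'n::finite) set)))"
proof -
  obtain V where V: "finite V" "X = convex hull V"
    "\<And>a. \<forall>v\<in>V. a \<bullet> v \<le> 1 \<Longrightarrow> \<exists>C. lattice_frame I C \<and> {v \<in> V. a \<bullet> v = 1} \<subseteq> C"
    using assms(1) unfolding unimodular_hull_def by blast
  obtain W where W: "finite W" "Y = convex hull W"
    "\<And>a. \<forall>v\<in>W. a \<bullet> v \<le> 1 \<Longrightarrow> \<exists>C. lattice_frame J C \<and> {v \<in> W. a \<bullet> v = 1} \<subseteq> C"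
    using assms(2) unfolding unimodular_hull_def by blast
  have "\<exists>E. lattice_frame (I \<union> J) E \<and> {v \<in> V \<union> W. a \<bullet> v = 1} \<subseteq> E"
    if le: "\<forall>v\<in>V \<union> W. a \<bullet> v \<le> 1" for a
  proof -
    have V1: "\<forall>v\<in>V. a \<bullet> v \<le> 1" and W1: "\<forall>v\<in>W. a \<bullet> v \<le> 1"
      using le by auto
    obtain C where "lattice_frame I C" "{v \<in> V. a \<bullet> v = 1} \<subseteq> C"
      using V(3)[OF V1] by (elim exE conjE)
    moreover obtain D where "lattice_frame J D" "{v \<in> W. a \<bullet> v = 1} \<subseteq> D"
      using W(3)[OF W1] by (elim exE conjE)
    ultimately show ?thesis
      using lattice_frame_Un[OF _ _ assms(3)] by (intro exI[of _ "C \<union> D"]) auto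
  qed
  moreover have "convex hull (V \<union> W) = convex hull (X \<union> Y)"
    unfolding V(2) W(2) by (rule hull_Un) (simp add: convex_Inter)
  ultimately show ?thesis
    unfolding unimodular_hull_def using V(1) W(1)
    by (intro exI[of _ "V \<union> W"]) simp
qed

section \<open>Facets of a Fano polytope with unimodular supporting hyperplanes\<close>

text \<open>The origin is a relative interior point, so no facet hyperplane passes through it, and
  the right-hand side can be scaled to 1.\<close>

lemma fano_facet:
  assumes "fano_in UNIV (X :: (real^'n::finite) set)" and "F facet_of X"
  shows "\<exists>a. (\<forall>x\<in>X. a \<bullet> x \<le> 1) \<and> F = X \<inter> {x. a \<bullet> x = 1}"
proof -
  have X: "polytope X" "0 \<in> rel_interior X"
    using assms(1) by (auto simp: fano_in_def)
  have F: "F face_of X" "F \<noteq> X"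
    using assms(2) by (auto simp: facet_of_def)
  then obtain a b where ab: "X \<subseteq> {x. a \<bullet> x \<le> b}" "F = X \<inter> {x. a \<bullet> x = b}"
    using exposed_face_of_polyhedron[OF polytope_imp_polyhedron[OF X(1)], of F]
    unfolding exposed_face_of_def by auto
  have 0: "0 \<in> X"
    using X(2) rel_interior_subset by blast
  have "b \<noteq> 0"
  proof
    assume b: "b = 0"
    have "a \<bullet> x = 0" if x: "x \<in> X" for x
    proof -
      \<comment> \<open>The segment from \<open>x\<close> to the origin can be prolonged inside
        \<open>X\<close>, and it then ends in a negative multiple of \<open>x\<close>.\<close>
      obtain e where e: "e > 1" "(1 - e) *\<^sub>R x + e *\<^sub>R 0 \<in> X"
        using convex_rel_interior_iff[of X 0] X x polytope_imp_convex by blast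
      then have "(1 - e) * (a \<bullet> x) \<le> 0"
        using ab(1) b by auto
      then have "a \<bullet> x \<ge> 0"
        using e(1) by (simp add: mult_le_0_iff)
      then show ?thesis
        using ab(1) b x by fastforce
    qed
    then show False
      using ab(2) b F(2) by auto
  qed
  moreover have "b \<ge> 0"
    using 0 ab(1) by auto
  ultimately have "b > 0"
    by simp
  then show ?thesis
    using ab by (intro exI[of _ "a /\<^sub>R b"]) (auto simp: field_simps)
qed

lemma unimodular_hull_facet:
  assumes fano: "fano_in UNIV (X :: (real^'n::finite) set)"
    and uni: "unimodular_hull UNIV X" and facet: "F facet_of X"
  shows "lattice_frame UNIV {v. v extreme_point_of F}"
proof -
  obtain a where a: "\<forall>x\<in>X. a \<bullet> x \<le> 1" "F = X \<inter> {x. a \<bullet> x = 1}"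
    using fano_facet[OF fano facet] by (elim exE conjE)
  obtain V where V: "finite V" "X = convex hull V"
    "\<And>a. \<forall>v\<in>V. a \<bullet> v \<le> 1 \<Longrightarrow> \<exists>C. lattice_frame UNIV C \<and> {v \<in> V. a \<bullet> v = 1} \<subseteq> C"
    using uni unfolding unimodular_hull_def by blast
  have "\<forall>v\<in>V. a \<bullet> v \<le> 1"
    using a(1) hull_subset[of V convex] unfolding V(2) by auto
  then obtain C where C: "lattice_frame UNIV C" "{v \<in> V. a \<bullet> v = 1} \<subseteq> C"
    using V(3) by blast
  have F: "F face_of X" "aff_dim F = aff_dim X - 1"
    using facet by (auto simp: facet_of_def)
  have poly: "polytope F"
    using F(1) fano face_of_polytope_polytope fano_in_def by blast
  \<comment> \<open>A vertex of the face \<open>F\<close> is a vertex of \<open>X\<close>, hence one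
    of the generators, and it lies on the hyperplane.\<close>
  have sub: "{v. v extreme_point_of F} \<subseteq> C"
    using extreme_point_of_face[OF F(1)] extreme_point_of_convex_hull V(2) a(2) C(2) by blast
  have fin: "finite C"
    using C(1) by (simp add: lattice_frame_def)
  have "aff_dim X = int CARD('n)"
    using fano aff_dim_affine_hull[of X] by (simp add: fano_in_def coord_space_def)
  moreover have "aff_dim F = aff_dim {v. v extreme_point_of F}"
    using Krein_Milman_Minkowski[of F] poly polytope_imp_compact polytope_imp_convex
    by (metis aff_dim_convex_hull)
  \<comment> \<open>A facet has affine dimension n - 1, and a finite set has affine dimension at
    most its size minus 1; so \<open>F\<close> has at least n vertices, as many as \<open>C\<close>
    has elements.\<close>
  ultimately have "int CARD('n) \<le> int (card {v. v extreme_point_of F})"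
    using F(2) aff_dim_le_card[OF finite_subset[OF sub fin]] by simp
  then have "card C \<le> card {v. v extreme_point_of F}"
    using lattice_frame_independent(2)[OF C(1)] by simp
  then have "{v. v extreme_point_of F} = C"
    using sub fin by (simp add: card_seteq)
  then show ?thesis
    using C(1) by simp
qed

lemma unimodular_hull_smooth:
  assumes "fano_in UNIV (X :: (real^'n::finite) set)" and "unimodular_hull UNIV X"
  shows "smooth_fano X"
  using assms unimodular_hull_facet lattice_frame_basis unfolding smooth_fano_def by blast

lemma unimodular_hull_Q_factorial:
  assumes "fano_in UNIV (X :: (real^'n::finite) set)" and "unimodular_hull UNIV X"
  shows "Q_factorial_fano X"
  unfolding Q_factorial_fano_def simplicial_def
proof (intro conjI allI impI assms(1))
  fix F assume facet: "F facet_of X"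
  let ?C = "{v. v extreme_point_of F}"
  have "\<not> affine_dependent ?C"
    using unimodular_hull_facet[OF assms facet] lattice_frame_independent(1)
      affine_dependent_imp_dependent by blast
  moreover have "polytope F"
    using facet assms(1) face_of_polytope_polytope unfolding facet_of_def fano_in_def by blast
  then have "F = convex hull ?C"
    using Krein_Milman_Minkowski[of F] polytope_imp_compact polytope_imp_convex by blast
  ultimately show "\<exists>k. k simplex F"
    unfolding simplex_def by (intro exI[of _ "int (card ?C) - 1"] exI[of _ ?C]) simp
qed

section \<open>Unimodular copies of the interval, the hexagon and the pentagon\<close>

lemma det_Ints:
  assumes "\<And>i j. A $ i $ j \<in> \<int>"
  shows "det (A :: real^'m^'m::finite) \<in> \<int>"
  unfolding det_def using assms by (intro Ints_sum Ints_mult Ints_prod) auto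

text \<open>Cramer's rule: the entries of the solution are integer determinants divided by
  \<open>det U\<close>, which is 1 or -1.\<close>

lemma unimodular_solvable:
  assumes "unimodular (U :: real^'m^'m::finite)" and "b \<in> int_lattice"
  obtains w where "w \<in> int_lattice" and "U *v w = b"
proof
  let ?w = "\<chi> k. det (\<chi> i j. if j = k then b $ i else U $ i $ j) / det U"
  have U: "\<bar>det U\<bar> = 1" "\<And>i j. U $ i $ j \<in> \<int>"
    using assms(1) by (auto simp: unimodular_def)
  show "U *v ?w = b"
    using cramer[of U ?w b] U(1) by auto
  have "det (\<chi> i j. if j = k then b $ i else U $ i $ j) \<in> \<int>" for k
    using assms(2) U(2) by (intro det_Ints) (auto simp: int_lattice_def)
  moreover have "det U = 1 \<or> det U = -1"
    using U(1) by linarith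
  ultimately show "?w \<in> int_lattice"
    by (auto simp: int_lattice_def)
qed

text \<open>This isolates what is used of a copy. The last property holds because \<open>U\<close>
  is surjective on integer vectors: the unit vector of a coordinate in \<open>I\<close> is the image
  of some integer vector, hence an integer combination of the images of the unit vectors.\<close>

lemma copy_in_linear:
  fixes V :: "(real^'m::finite) set" and X :: "(real^'n::finite) set"
  assumes "copy_in V I X"
  obtains f where "linear f" and "X = f ` V" and "card I = CARD('m)"
    and "\<And>j. f (axis j 1) \<in> int_lattice"
    and "\<And>i. i \<in> I \<Longrightarrow> axis i 1 \<in> int_module.span (range (\<lambda>j. f (axis j 1)))"
proof -
  obtain \<sigma> :: "'m \<Rightarrow> 'n" and U where \<sigma>: "bij_betw \<sigma> UNIV I" and U: "unimodular U"
    and X: "X = (\<lambda>v. \<Sum>j\<in>UNIV. (U *v v) $ j *\<^sub>R axis (\<sigma> j) 1) ` V"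
    using assms unfolding copy_in_def by blast
  define f :: "real^'m \<Rightarrow> real^'n" where "f v = (\<Sum>j\<in>UNIV. (U *v v) $ j *\<^sub>R axis (\<sigma> j) 1)" for v
  have lin: "linear f"
    by (rule linearI)
      (simp_all add: f_def matrix_vector_right_distrib matrix_vector_mult_scaleR scaleR_sum_right
        sum.distrib scaleR_left_distrib)
  have int: "f v \<in> int_lattice" if v: "v \<in> int_lattice" for v
  proof -
    have "(U *v v) $ j \<in> \<int>" for j
      using U v by (auto simp: matrix_vector_mult_def unimodular_def int_lattice_def)
    then show ?thesis
      by (auto simp: f_def int_lattice_def axis_def)
  qed
  have ax: "(axis j 1 :: real^'m) \<in> int_lattice" for j
    by (simp add: int_lattice_def axis_def)
  have "axis i 1 \<in> int_module.span (range (\<lambda>j. f (axis j 1)))" if i: "i \<in> I" for i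
  proof -
    obtain j where j: "i = \<sigma> j"
      using i \<sigma> by (auto simp: bij_betw_def)
    obtain w where w: "w \<in> int_lattice" "U *v w = axis j 1"
      by (rule unimodular_solvable[OF U ax])
    have "f w = axis i 1"
      unfolding f_def w(2) j by (simp add: axis_def if_distrib[of "\<lambda>c. c *\<^sub>R _"] cong: if_cong)
    have "\<forall>l. \<exists>k. w $ l = of_int k"
      using w(1) by (auto simp: int_lattice_def elim: Ints_cases)
    then obtain k where k: "\<And>l. w $ l = of_int (k l)"
      by metis
    have "w = (\<Sum>l\<in>UNIV. of_int (k l) *\<^sub>R axis l 1)"
      by (simp add: vec_eq_iff k axis_def if_distrib cong: if_cong)
    then have "f w = (\<Sum>l\<in>UNIV. of_int (k l) *\<^sub>R f (axis l 1))"
      by (simp add: linear_sum[OF lin] linear_scale[OF lin])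
    also have "\<dots> \<in> int_module.span (range (\<lambda>j. f (axis j 1)))"
      by (intro int_module.span_sum int_module.span_scale int_module.span_base) auto
    finally show ?thesis
      using \<open>f w = axis i 1\<close> by simp
  qed
  then show thesis
    using lin X int ax bij_betw_same_card[OF \<sigma>] by (intro that[of f]) (auto simp: f_def)
qed

lemma lattice_frame_exchange:
  assumes "card I = 2" and "\<And>i. i \<in> I \<Longrightarrow> axis i 1 \<in> int_module.span {u, v}"
    and "x \<in> int_lattice" and "y \<in> int_lattice"
    and "u \<in> int_module.span {x, y}" and "v \<in> int_module.span {x, y :: real^'n::finite}"
  shows "lattice_frame I {x, y}"
proof -
  have "int_module.span {u, v} \<subseteq> int_module.span {x, y}"
    using assms(5,6) by (intro int_module.span_minimal int_module.subspace_span) auto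
  moreover have "card {x, y} \<le> 2"
    by (simp add: card_insert_if)
  ultimately show ?thesis
    using assms(1-4) unfolding lattice_frame_def by auto
qed

text \<open>In cyclic order the hexagon has the vertices u, u + v, v, -u, -(u + v), -v. The list
  consists of its six edges and of the pair -u, -v, the edge that appears when -(u + v) is dropped,
  so that the pentagon is served as well. Each pair has determinant 1 or -1 with respect to u,
  v.\<close>

lemma lattice_frame_hexagon_edges:
  assumes "card I = 2" and "\<And>i. i \<in> I \<Longrightarrow> axis i 1 \<in> int_module.span {u, v}"
    and "u \<in> int_lattice" and "v \<in> (int_lattice :: (real^'n::finite) set)"
    and "(x, y) \<in> {(u, u + v), (v, u + v), (u, - v), (- u, v), (- u, - v),
      (- u, - (u + v)), (- v, - (u + v))}"
  shows "lattice_frame I {x, y}"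
proof -
  have comb: "z \<in> int_module.span {x, y}" if "z = of_int k *\<^sub>R x + of_int l *\<^sub>R y" for z k l
    unfolding that
    by (intro int_module.span_add int_module.span_scale int_module.span_base) auto
  have neg: "- z \<in> int_lattice" if "z \<in> int_lattice" for z :: "real^'n"
    using that by (simp add: int_lattice_def)
  have add: "y + z \<in> int_lattice" if "y \<in> int_lattice" "z \<in> int_lattice" for y z :: "real^'n"
    using that by (simp add: int_lattice_def)
  have "x \<in> int_lattice" "y \<in> int_lattice"
    using assms(3-5) by (auto intro: neg add simp del: minus_add_distrib)
  moreover have "u \<in> int_module.span {x, y} \<and> v \<in> int_module.span {x, y}"
    using assms(5) comb[of u 1 0] comb[of v 1 0] comb[of v 0 1] comb[of u 0 1] comb[of u "-1" 0]
      comb[of v "-1" 0] comb[of v 0 "-1"] comb[of u "-1" 1] comb[of v "-1" 1]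
      comb[of u 1 "-1"] comb[of v 1 "-1"]
    by auto
  ultimately show ?thesis
    using assms(1,2) lattice_frame_exchange by blast
qed

lemma unimodular_hull_hexagon:
  assumes "card I = 2" and "\<And>i. i \<in> I \<Longrightarrow> axis i 1 \<in> int_module.span {u, v}"
    and "u \<in> int_lattice" and "v \<in> (int_lattice :: (real^'n::finite) set)"
  shows "unimodular_hull I (convex hull {u, - u, v, - v, u + v, - (u + v)})" (is "unimodular_hull _ (_ hull ?V)")
  unfolding unimodular_hull_def
proof (rule exI[of _ ?V], intro conjI allI impI refl)
  fix a assume "\<forall>w\<in>?V. a \<bullet> w \<le> 1"
  then have le: "a \<bullet> u \<le> 1" "- (a \<bullet> u) \<le> 1" "a \<bullet> v \<le> 1" "- (a \<bullet> v) \<le> 1"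
    "a \<bullet> u + a \<bullet> v \<le> 1" "- (a \<bullet> u + a \<bullet> v) \<le> 1"
    by (auto simp: inner_simps)
  \<comment> \<open>The cases sort out which vertices can have value 1. Where at most one vertex
    does, any edge containing it will do.\<close>
  consider "a \<bullet> u = 1" "a \<bullet> v = -1" | "a \<bullet> u = -1" "a \<bullet> v = 1"
    | "a \<bullet> u = 1" "a \<bullet> v \<noteq> -1" | "a \<bullet> v = 1" "a \<bullet> u \<noteq> -1"
    | "a \<bullet> u < 1" "a \<bullet> v < 1" "a \<bullet> u + a \<bullet> v = 1"
    | "a \<bullet> u < 1" "a \<bullet> v < 1" "a \<bullet> u + a \<bullet> v < 1" "a \<bullet> u = -1"
    | "a \<bullet> u < 1" "a \<bullet> v < 1" "a \<bullet> u + a \<bullet> v < 1" "a \<bullet> u \<noteq> -1"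
    using le by linarith
  then have "\<exists>x y. (x, y) \<in> {(u, u + v), (v, u + v), (u, - v), (- u, v), (- u, - v),
      (- u, - (u + v)), (- v, - (u + v))} \<and> {w \<in> ?V. a \<bullet> w = 1} \<subseteq> {x, y}"
  proof cases
    case 1 then show ?thesis using le by (intro exI[of _ u] exI[of _ "- v"]) (auto simp: inner_simps)
  next
    case 2 then show ?thesis using le by (intro exI[of _ "- u"] exI[of _ v]) (auto simp: inner_simps)
  next
    case 3 then show ?thesis using le by (intro exI[of _ u] exI[of _ "u + v"]) (auto simp: inner_simps)
  next
    case 4 then show ?thesis using le by (intro exI[of _ v] exI[of _ "u + v"]) (auto simp: inner_simps)
  next
    case 5 then show ?thesis using le by (intro exI[of _ u] exI[of _ "u + v"]) (auto simp: inner_simps)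
  next
    case 6 then show ?thesis using le by (intro exI[of _ "- u"] exI[of _ "- (u + v)"]) (auto simp: inner_simps)
  next
    case 7 then show ?thesis using le by (intro exI[of _ "- v"] exI[of _ "- (u + v)"]) (auto simp: inner_simps)
  qed
  then show "\<exists>C. lattice_frame I C \<and> {w \<in> ?V. a \<bullet> w = 1} \<subseteq> C"
    using lattice_frame_hexagon_edges[OF assms] by meson
qed auto

text \<open>Without the vertex -(u + v) the functional may take the value -1 on both u and v, so the
  last two cases of the hexagon merge into one, with edge -u, -v.\<close>

lemma unimodular_hull_pentagon:
  assumes "card I = 2" and "\<And>i. i \<in> I \<Longrightarrow> axis i 1 \<in> int_module.span {u, v}"
    and "u \<in> int_lattice" and "v \<in> (int_lattice :: (real^'n::finite) set)"
  shows "unimodular_hull I (convex hull {u, - u, v, - v, u + v})" (is "unimodular_hull _ (_ hull ?V)")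
  unfolding unimodular_hull_def
proof (rule exI[of _ ?V], intro conjI allI impI refl)
  fix a assume "\<forall>w\<in>?V. a \<bullet> w \<le> 1"
  then have le: "a \<bullet> u \<le> 1" "- (a \<bullet> u) \<le> 1" "a \<bullet> v \<le> 1" "- (a \<bullet> v) \<le> 1"
    "a \<bullet> u + a \<bullet> v \<le> 1"
    by (auto simp: inner_simps)
  consider "a \<bullet> u = 1" "a \<bullet> v = -1" | "a \<bullet> u = -1" "a \<bullet> v = 1"
    | "a \<bullet> u = 1" "a \<bullet> v \<noteq> -1" | "a \<bullet> v = 1" "a \<bullet> u \<noteq> -1"
    | "a \<bullet> u < 1" "a \<bullet> v < 1" "a \<bullet> u + a \<bullet> v = 1"
    | "a \<bullet> u < 1" "a \<bullet> v < 1" "a \<bullet> u + a \<bullet> v < 1"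
    using le by linarith
  then have "\<exists>x y. (x, y) \<in> {(u, u + v), (v, u + v), (u, - v), (- u, v), (- u, - v),
      (- u, - (u + v)), (- v, - (u + v))} \<and> {w \<in> ?V. a \<bullet> w = 1} \<subseteq> {x, y}"
  proof cases
    case 1 then show ?thesis using le by (intro exI[of _ u] exI[of _ "- v"]) (auto simp: inner_simps)
  next
    case 2 then show ?thesis using le by (intro exI[of _ "- u"] exI[of _ v]) (auto simp: inner_simps)
  next
    case 3 then show ?thesis using le by (intro exI[of _ u] exI[of _ "u + v"]) (auto simp: inner_simps)
  next
    case 4 then show ?thesis using le by (intro exI[of _ v] exI[of _ "u + v"]) (auto simp: inner_simps)
  next
    case 5 then show ?thesis using le by (intro exI[of _ u] exI[of _ "u + v"]) (auto simp: inner_simps)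
  next
    case 6 then show ?thesis using le by (intro exI[of _ "- u"] exI[of _ "- v"]) (auto simp: inner_simps)
  qed
  then show "\<exists>C. lattice_frame I C \<and> {w \<in> ?V. a \<bullet> w = 1} \<subseteq> C"
    using lattice_frame_hexagon_edges[OF assms] by meson
qed auto

lemma unimodular_hull_interval:
  assumes "card I = 1" and "\<And>i. i \<in> I \<Longrightarrow> axis i 1 \<in> int_module.span {u}"
    and "u \<in> (int_lattice :: (real^'n::finite) set)"
  shows "unimodular_hull I (convex hull {u, - u})"
  unfolding unimodular_hull_def
proof (rule exI[of _ "{u, - u}"], intro conjI allI impI refl)
  fix a
  have "u \<in> int_module.span {- u}"
    using int_module.span_neg[of "- u" "{- u}"] by (simp add: int_module.span_base)
  then have "int_module.span {u} \<subseteq> int_module.span {- u}"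
    by (intro int_module.span_minimal int_module.subspace_span) auto
  then have "lattice_frame I {u}" "lattice_frame I {- u}"
    using assms by (auto simp: lattice_frame_def int_lattice_def)
  moreover have "{v \<in> {u, - u}. a \<bullet> v = 1} \<subseteq> {u} \<or> {v \<in> {u, - u}. a \<bullet> v = 1} \<subseteq> {- u}"
    by auto
  ultimately show "\<exists>C. lattice_frame I C \<and> {v \<in> {u, - u}. a \<bullet> v = 1} \<subseteq> C"
    by blast
qed auto

lemma symmetric_interval_hull: "symmetric_interval = convex hull {axis 1 1, - axis 1 1}"
proof -
  have "x \<in> symmetric_interval \<longleftrightarrow> x \<in> closed_segment (axis 1 1) (- axis 1 1)" for x :: "real^1"
  proof -
    have "x \<in> symmetric_interval \<longleftrightarrow> (\<exists>t\<ge>0. t \<le> 1 \<and> x $ 1 = (1 - t) - t)"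
      unfolding symmetric_interval_def by (auto intro!: exI[of _ "(1 - x $ 1) / 2"] simp: field_simps)
    then show ?thesis
      by (auto simp: in_segment vec_eq_iff axis_def forall_1)
  qed
  then show ?thesis
    by (auto simp: segment_convex_hull)
qed

lemma copy_unimodular_hull:
  assumes "copy_in symmetric_interval I X \<or> copy_in del_Pezzo I X \<or> copy_in pseudo_del_Pezzo I X"
  shows "unimodular_hull I (X :: (real^'n::finite) set)"
  using assms
proof (elim disjE)
  assume "copy_in symmetric_interval I X"
  then obtain f where f: "linear f" "X = f ` symmetric_interval" "card I = CARD(1)"
    "\<And>j. f (axis j 1) \<in> int_lattice"
    "\<And>i. i \<in> I \<Longrightarrow> axis i 1 \<in> int_module.span (range (\<lambda>j. f (axis j 1)))"
    using copy_in_linear by blast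
  then show ?thesis
    using unimodular_hull_interval[of I "f (axis 1 1)"]
    by (simp add: symmetric_interval_hull convex_hull_linear_image linear_neg[OF f(1)] UNIV_1)
next
  assume "copy_in del_Pezzo I X"
  then obtain f where f: "linear f" "X = f ` del_Pezzo" "card I = CARD(2)"
    "\<And>j. f (axis j 1) \<in> int_lattice"
    "\<And>i. i \<in> I \<Longrightarrow> axis i 1 \<in> int_module.span (range (\<lambda>j. f (axis j 1)))"
    using copy_in_linear by blast
  then show ?thesis
    using unimodular_hull_hexagon[of I "f (axis 1 1)" "f (axis 2 1)"]
    by (simp add: del_Pezzo_def convex_hull_linear_image linear_neg[OF f(1)] linear_add[OF f(1)]
        linear_diff[OF f(1)] UNIV_2)
next
  assume "copy_in pseudo_del_Pezzo I X"
  then obtain f where f: "linear f" "X = f ` pseudo_del_Pezzo" "card I = CARD(2)"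
    "\<And>j. f (axis j 1) \<in> int_lattice"
    "\<And>i. i \<in> I \<Longrightarrow> axis i 1 \<in> int_module.span (range (\<lambda>j. f (axis j 1)))"
    using copy_in_linear by blast
  then show ?thesis
    using unimodular_hull_pentagon[of I "f (axis 1 1)" "f (axis 2 1)"]
    by (simp add: pseudo_del_Pezzo_def convex_hull_linear_image linear_neg[OF f(1)]
        linear_add[OF f(1)] UNIV_2)
qed

lemma splits_into_fano: "splits_into K I X \<Longrightarrow> fano_in I X"
  by (induction rule: splits_into.induct) (auto simp: splits_def)

lemma splits_into_unimodular_hull:
  assumes "splits_into
    (\<lambda>I X. copy_in symmetric_interval I X \<or> copy_in del_Pezzo I X \<or> copy_in pseudo_del_Pezzo I X)
    I (X :: (real^'n::finite) set)"
  shows "unimodular_hull I X"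
  using assms
proof (induction rule: splits_into.induct)
  case (piece I X)
  then show ?case
    using copy_unimodular_hull by blast
next
  case (split I X I1 X1 I2 X2)
  then show ?case
    using unimodular_hull_Un[of I1 X1 I2 X2] by (auto simp: splits_def)
qed

section \<open>Fano polytopes spanned by cliques\<close>

lemma coord_space_subspace: "subspace (coord_space J)"
  by (auto simp: subspace_def coord_space_def)

text \<open>The hull lies in the cube with entries between -1 and 1. A nonzero lattice point has an
  entry of absolute value at least 1; were it relatively interior, it could be stretched away from
  the origin by a factor greater than 1 and would leave the cube. The signed unit vectors make the
  origin itself relatively interior.\<close>

lemma fano_in_convex_hull:
  fixes V :: "(real^'n::finite) set"
  assumes "finite V" and "V \<subseteq> int_lattice" and "V \<subseteq> coord_space J"
    and bound: "\<And>v i. v \<in> V \<Longrightarrow> \<bar>v $ i\<bar> \<le> 1"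
    and "0 \<in> V" and ax: "\<And>i. i \<in> J \<Longrightarrow> axis i 1 \<in> V" "\<And>i. i \<in> J \<Longrightarrow> - axis i 1 \<in> V"
  shows "fano_in J (convex hull V)"
proof -
  let ?X = "convex hull V"
  have sub: "V \<subseteq> ?X"
    by (rule hull_subset)
  have span: "span V = coord_space J"
  proof
    show "span V \<subseteq> coord_space J"
      by (intro span_minimal coord_space_subspace assms)
    show "coord_space J \<subseteq> span V"
    proof
      fix x assume x: "x \<in> coord_space J"
      have "x = (\<Sum>i\<in>UNIV. x $ i *\<^sub>R axis i 1)"
        by (simp add: vec_eq_iff axis_def if_distrib cong: if_cong)
      also have "\<dots> = (\<Sum>i\<in>J. x $ i *\<^sub>R axis i 1)"
        using x by (intro sum.mono_neutral_right) (auto simp: coord_space_def)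
      also have "\<dots> \<in> span V"
        by (intro span_sum span_scale span_base ax)
      finally show "x \<in> span V" .
    qed
  qed
  have aff: "affine hull ?X = coord_space J"
    using affine_hull_span_0[of V] \<open>0 \<in> V\<close> span by (simp add: affine_hull_convex_hull hull_inc)
  have "V \<subseteq> cbox (\<chi> i. -1) (\<chi> i. 1)"
    using bound by (force simp: mem_box_cart abs_le_iff)
  then have box: "\<bar>x $ i\<bar> \<le> 1" if "x \<in> ?X" for x i
    using subsetD[OF hull_minimal[of V "cbox (\<chi> i. -1) (\<chi> i. 1)" convex] that]
    by (force simp: mem_box_cart abs_le_iff)
  have rel: "z \<in> rel_interior ?X \<longleftrightarrow> (\<forall>x\<in>?X. \<exists>e. e > 1 \<and> (1 - e) *\<^sub>R x + e *\<^sub>R z \<in> ?X)" for z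
    using \<open>0 \<in> V\<close> by (intro convex_rel_interior_iff) auto
  have "0 \<in> rel_interior ?X"
    unfolding rel
  proof
    fix x assume x: "x \<in> ?X"
    have supp: "x \<in> coord_space J"
      using x aff hull_subset[of ?X affine] by auto
    \<comment> \<open>For \<open>i\<close> in \<open>J\<close> this point lies on the segment
      between the two signed unit vectors; for other \<open>i\<close> it is the origin.\<close>
    have seg: "- (x $ i) *\<^sub>R axis i 1 \<in> ?X" for i
    proof (cases "i \<in> J")
      case True
      have "((1 - x $ i) / 2) *\<^sub>R axis i 1 + ((1 + x $ i) / 2) *\<^sub>R (- axis i 1) \<in> ?X"
        using ax[OF True] sub box[OF x, of i] by (intro convexD) (auto simp: field_simps abs_le_iff)
      also have "((1 - x $ i) / 2) *\<^sub>R axis i 1 + ((1 + x $ i) / 2) *\<^sub>R (- axis i 1) =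
          (- (x $ i) *\<^sub>R axis i 1 :: real^'n)"
        by (simp add: vec_eq_iff axis_def field_simps)
      finally show ?thesis .
    next
      case False
      then show ?thesis
        using supp \<open>0 \<in> V\<close> sub by (auto simp: coord_space_def)
    qed
    \<comment> \<open>The average of these n points is -x/n, so the segment from \<open>x\<close> to
      the origin can be prolonged by the factor 1 + 1/n.\<close>
    have "(\<Sum>i\<in>UNIV. (1 / real CARD('n)) *\<^sub>R (- (x $ i) *\<^sub>R axis i 1)) \<in> ?X"
      by (rule convex_sum) (auto intro: seg[simplified])
    also have "(\<Sum>i\<in>UNIV. (1 / real CARD('n)) *\<^sub>R (- (x $ i) *\<^sub>R axis i 1)) =
        - (1 / real CARD('n)) *\<^sub>R x"
      by (simp add: vec_eq_iff axis_def if_distrib sum_negf cong: if_cong)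
    finally show "\<exists>e. e > 1 \<and> (1 - e) *\<^sub>R x + e *\<^sub>R 0 \<in> ?X"
      by (intro exI[of _ "1 + 1 / real CARD('n)"]) simp
  qed
  moreover have "z = 0" if z: "z \<in> rel_interior ?X" "z \<in> int_lattice" for z
  proof (rule ccontr)
    assume "z \<noteq> 0"
    then obtain i where i: "z $ i \<noteq> 0"
      by (auto simp: vec_eq_iff)
    then have "\<bar>z $ i\<bar> \<ge> 1"
      using z(2) Ints_nonzero_abs_ge1 unfolding int_lattice_def by blast
    have "0 \<in> ?X"
      using \<open>0 \<in> V\<close> sub by blast
    then obtain e where e: "e > 1" "(1 - e) *\<^sub>R 0 + e *\<^sub>R z \<in> ?X"
      using z(1) rel by blast
    have "1 < e * \<bar>z $ i\<bar>"
      using e(1) \<open>\<bar>z $ i\<bar> \<ge> 1\<close> mult_left_mono[of 1 "\<bar>z $ i\<bar>" e] by linarith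
    then show False
      using box[OF e(2), of i] e(1) by (simp add: abs_mult)
  qed
  moreover have "0 \<in> (int_lattice :: (real^'n) set)"
    by (simp add: int_lattice_def)
  ultimately have "rel_interior ?X \<inter> int_lattice = {0}"
    by blast
  moreover have "polytope ?X"
    using \<open>finite V\<close> by (auto simp: polytope_def)
  moreover have "\<forall>v. v extreme_point_of ?X \<longrightarrow> v \<in> int_lattice"
    using extreme_point_of_convex_hull assms(2) by blast
  ultimately show ?thesis
    using aff by (simp add: fano_in_def)
qed

section \<open>Clique polytopes and their vertices\<close>

definition indicator_vec :: "'n set \<Rightarrow> real^'n::finite" where
  "indicator_vec S = (\<chi> i. if i \<in> S then 1 else 0)"

definition clique_points :: "('n \<Rightarrow> 'n \<Rightarrow> bool) \<Rightarrow> ('n \<Rightarrow> 'n \<Rightarrow> bool) \<Rightarrow> (real^'n::finite) set" where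
  "clique_points G H =
     indicator_vec ` {S. pairwise G S} \<union> (\<lambda>S. - indicator_vec S) ` {S. pairwise H S}"

lemma indicator_vec_nth [simp]: "indicator_vec S $ i = (if i \<in> S then 1 else 0)"
  by (simp add: indicator_vec_def)

lemma indicator_vec_inject [simp]: "indicator_vec S = indicator_vec T \<longleftrightarrow> S = T"
  by (auto simp: vec_eq_iff)

lemma indicator_vec_empty [simp]: "indicator_vec {} = 0"
  by (simp add: vec_eq_iff)

lemma indicator_vec_singleton: "indicator_vec {i} = axis i 1"
  by (simp add: vec_eq_iff axis_def)

lemma indicator_vec_pair: "i \<noteq> j \<Longrightarrow> indicator_vec {i, j} = axis i 1 + axis j 1"
  by (auto simp: vec_eq_iff axis_def)

lemma indicator_vec_coord_space [simp]: "indicator_vec S \<in> coord_space J \<longleftrightarrow> S \<subseteq> J"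
  "- indicator_vec S \<in> coord_space J \<longleftrightarrow> S \<subseteq> J"
  by (auto simp: coord_space_def)

lemma inner_indicator_vec: "a \<bullet> indicator_vec S = (\<Sum>i\<in>S. a $ i)"
  by (simp add: inner_vec_def sum.If_cases of_bool_def if_distrib cong: if_cong)

lemma finite_clique_points: "finite (clique_points G H)"
  by (simp add: clique_points_def)

lemma clique_points_uminus: "- x \<in> clique_points G H \<longleftrightarrow> x \<in> clique_points H G"
  unfolding clique_points_def by (auto simp: image_iff) (metis minus_minus)+

lemma fano_in_clique_points: "fano_in J (convex hull (clique_points G H \<inter> coord_space J))"
proof (rule fano_in_convex_hull)
  show "0 \<in> clique_points G H \<inter> coord_space J"
    by (auto simp: clique_points_def coord_space_def image_iff intro!: exI[of _ "{}"])
  fix i assume "i \<in> J"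
  then show "axis i 1 \<in> clique_points G H \<inter> coord_space J"
    "- axis i 1 \<in> clique_points G H \<inter> coord_space J"
    unfolding indicator_vec_singleton[symmetric] by (auto simp: clique_points_def)
qed (auto simp: finite_clique_points clique_points_def int_lattice_def)

text \<open>Weight N = n on \<open>S\<close> and -1 outside \<open>S\<close> makes
  \<open>indicator_vec S\<close> the strict maximum. A set missing an element of \<open>S\<close>
  loses at least N, a proper superset of \<open>S\<close> loses 1 for each extra element, and a
  negated indicator reaches at most \<open>card (T - S)\<close>, which is below N since
  \<open>S\<close> is nonempty.\<close>

lemma clique_points_exposed:
  assumes "pairwise G S" and "S \<noteq> {}"
  obtains a where "\<And>w. w \<in> clique_points G H \<Longrightarrow> w \<noteq> indicator_vec S \<Longrightarrow>
    a \<bullet> w < a \<bullet> (indicator_vec S :: real^'n::finite)"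
proof -
  define N where "N = CARD('n)"
  define a :: "real^'n" where "a = (\<chi> i. if i \<in> S then real N else -1)"
  have a: "a \<bullet> indicator_vec T = real (N * card (T \<inter> S)) - real (card (T - S))" for T
  proof -
    have "a \<bullet> indicator_vec T = (\<Sum>i\<in>T \<inter> S. a $ i) + (\<Sum>i\<in>T - S. a $ i)"
      by (simp add: inner_indicator_vec sum.Int_Diff[of T _ S])
    then show ?thesis
      by (simp add: a_def)
  qed
  have S: "card S \<ge> 1"
    using assms(2) by (simp add: Suc_le_eq card_gt_0_iff)
  have N: "N \<ge> 1"
    by (simp add: N_def Suc_le_eq)
  have "a \<bullet> w < a \<bullet> indicator_vec S" if w: "w \<in> clique_points G H" "w \<noteq> indicator_vec S" for w
  proof -
    consider T where "w = indicator_vec T" "T \<noteq> S" | T where "w = - indicator_vec T"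
      using w unfolding clique_points_def by auto
    then show ?thesis
    proof cases
      case 1
      show ?thesis
      proof (cases "S \<subseteq> T")
        case True
        then have "card (T - S) > 0" "T \<inter> S = S"
          using 1(2) by (auto simp: card_gt_0_iff)
        then show ?thesis
          by (simp add: 1(1) a)
      next
        case False
        then have "card (T \<inter> S) < card S"
          by (intro psubset_card_mono) auto
        then have "real (N * card (T \<inter> S)) < real (N * card S)"
          using N by (simp del: of_nat_mult)
        then show ?thesis
          unfolding 1(1) a Int_absorb Diff_cancel card.empty by linarith
      qed
    next
      case 2
      have "card (T - S) < N"
        using assms(2) unfolding N_def by (intro psubset_card_mono) auto
      also have "N \<le> N * card S"
        using S by simp
      finally have "real (card (T - S)) < real (N * card S)"
        by (simp del: of_nat_mult)
      moreover have "0 \<le> real (N * card (T \<inter> S))"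
        by simp
      ultimately have "real (card (T - S)) - real (N * card (T \<inter> S)) < real (N * card S)"
        by linarith
      then show ?thesis
        by (simp add: 2 a del: of_nat_mult)
    qed
  qed
  then show thesis
    by (rule that)
qed

text \<open>The other points lie in an open half-space that misses \<open>v\<close>, so
  \<open>v\<close> is outside their hull and becomes a vertex when it is added.\<close>

lemma exposed_imp_extreme:
  assumes "finite V" and "v \<in> V" and "\<And>w. w \<in> V \<Longrightarrow> w \<noteq> v \<Longrightarrow> a \<bullet> w < a \<bullet> (v :: 'a::euclidean_space)"
  shows "v extreme_point_of (convex hull V)"
proof -
  have "convex hull (V - {v}) \<subseteq> {x. a \<bullet> x < a \<bullet> v}"
    using assms(3) by (intro hull_minimal convex_halfspace_lt) auto
  then have "v extreme_point_of (convex hull (insert v (V - {v})))"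
    using assms(1) by (intro extreme_point_of_convex_hull_insert) auto
  then show ?thesis
    using assms(2) by (simp add: insert_absorb)
qed

lemma clique_extreme:
  assumes "pairwise G S" and "S \<noteq> {}"
  shows "indicator_vec S extreme_point_of (convex hull (clique_points G H))"
proof -
  obtain a where "\<And>w. w \<in> clique_points G H \<Longrightarrow> w \<noteq> indicator_vec S \<Longrightarrow> a \<bullet> w < a \<bullet> indicator_vec S"
    using clique_points_exposed[OF assms] by blast
  then show ?thesis
    using assms(1) by (intro exposed_imp_extreme finite_clique_points) (auto simp: clique_points_def)
qed

text \<open>Negation exchanges the roles of \<open>G\<close> and \<open>H\<close>, so the negated
  functional that exposes \<open>S\<close> for \<open>H\<close> works.\<close>

lemma clique_extreme_neg:
  assumes "pairwise H S" and "S \<noteq> {}"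
  shows "(- indicator_vec S) extreme_point_of (convex hull (clique_points G H))"
proof -
  obtain a where a: "\<And>w. w \<in> clique_points H G \<Longrightarrow> w \<noteq> indicator_vec S \<Longrightarrow> a \<bullet> w < a \<bullet> indicator_vec S"
    using clique_points_exposed[OF assms] by blast
  show ?thesis
  proof (rule exposed_imp_extreme[of _ _ "- a"])
    fix w assume w: "w \<in> clique_points G H" "w \<noteq> - indicator_vec S"
    then show "- a \<bullet> w < - a \<bullet> - indicator_vec S"
      using a[of "- w"] by (simp add: clique_points_uminus minus_equation_iff) (metis minus_minus)
  qed (use assms(1) finite_clique_points in \<open>auto simp: clique_points_def\<close>)
qed

section \<open>Parallelograms of vertices on a supporting hyperplane\<close>

text \<open>Extreme points of a hull are among its generators, so all four points belong to one
  affinely independent set, while u = v + w - z is an affine combination of the other three.\<close>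

lemma simplex_no_parallelogram:
  assumes "k simplex F" and "u extreme_point_of F" "v extreme_point_of F" "w extreme_point_of F"
    "z extreme_point_of F" and "distinct [u, v, w, z]"
  shows "u + z \<noteq> v + w"
proof
  assume eq: "u + z = v + w"
  obtain C where C: "\<not> affine_dependent C" "F = convex hull C"
    using assms(1) by (auto simp: simplex_def)
  then have in_C: "u \<in> C" "v \<in> C" "w \<in> C" "z \<in> C"
    using assms(2-5) extreme_point_of_convex_hull by blast+
  have "u = 1 *\<^sub>R v + 1 *\<^sub>R w + (-1) *\<^sub>R z"
    using eq by (simp add: algebra_simps)
  then have "u \<in> affine hull {v, w, z}"
    unfolding affine_hull_3 by (smt (verit, best) mem_Collect_eq)
  also have "\<dots> \<subseteq> affine hull (C - {u})"
    using in_C assms(6) by (intro hull_mono) auto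
  finally show False
    using C(1) in_C(1) unfolding affine_dependent_def by blast
qed

lemma lattice_basis_no_parallelogram:
  assumes "lattice_basis B" and "u \<in> B" "v \<in> B" "w \<in> B" "z \<in> B" and "distinct [u, v, w, z]"
  shows "u + z \<noteq> v + w"
proof
  assume eq: "u + z = v + w"
  let ?k = "\<lambda>x. if x = u \<or> x = z then 1 else -1 :: int"
  have "(\<Sum>x\<in>{u, v, w, z}. of_int (?k x) *\<^sub>R x) = 0"
    using assms(6) eq by (auto simp: algebra_simps)
  moreover have "{u, v, w, z} \<subseteq> B" "finite {u, v, w, z}"
    using assms by auto
  ultimately have "int_module.dependent B"
    unfolding int_module.dependent_explicit by (intro exI[of _ "{u, v, w, z}"] exI[of _ ?k]) auto
  then show False
    using assms(1) by (simp add: lattice_basis_def)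
qed

text \<open>The face is proper because the origin lies in \<open>X\<close> but off the hyperplane; a
  nonempty proper face of a polyhedron is contained in a facet.\<close>

lemma facet_through_supporting_face:
  assumes "fano_in UNIV X" and "\<And>x. x \<in> X \<Longrightarrow> a \<bullet> x \<le> 1" and "v \<in> X" and "a \<bullet> v = 1"
  obtains F where "F facet_of X" and "X \<inter> {x. a \<bullet> x = 1} \<subseteq> F"
proof (rule face_of_polyhedron_subset_facet)
  have "0 \<in> X"
    using assms(1) rel_interior_subset unfolding fano_in_def by blast
  then show "X \<inter> {x. a \<bullet> x = 1} \<noteq> X"
    by force
  show "X \<inter> {x. a \<bullet> x = 1} \<noteq> {}"
    using assms(3,4) by blast
  show "polyhedron X"
    using assms(1) by (simp add: fano_in_def polytope_imp_polyhedron)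
  then show "X \<inter> {x. a \<bullet> x = 1} face_of X"
    using assms(2) by (intro face_of_Int_supporting_hyperplane_le polyhedron_imp_convex)
qed

text \<open>The hyperplane may support a face of any dimension: in a facet containing that face the
  four points are still vertices, and there either hypothesis excludes the relation.\<close>

lemma supporting_face_no_parallelogram:
  assumes X: "Q_factorial_fano X \<or> smooth_fano X" and le: "\<And>x. x \<in> X \<Longrightarrow> a \<bullet> x \<le> 1"
    and ext: "u extreme_point_of X" "v extreme_point_of X" "w extreme_point_of X" "z extreme_point_of X"
    and on: "a \<bullet> u = 1" "a \<bullet> v = 1" "a \<bullet> w = 1" "a \<bullet> z = 1" and dist: "distinct [u, v, w, z]"
  shows "u + z \<noteq> v + w"
proof -
  have mem: "u \<in> X" "v \<in> X" "w \<in> X" "z \<in> X"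
    using ext by (auto simp: extreme_point_of_def)
  have fano: "fano_in UNIV X"
    using X by (auto simp: Q_factorial_fano_def smooth_fano_def)
  obtain F where F: "F facet_of X" "X \<inter> {x. a \<bullet> x = 1} \<subseteq> F"
    using facet_through_supporting_face[OF fano le mem(1) on(1)] by blast
  have "x extreme_point_of F" if "x extreme_point_of X" "a \<bullet> x = 1" for x
    using F that extreme_point_of_face[of F X x] unfolding facet_of_def extreme_point_of_def by blast
  then have ext_F: "u extreme_point_of F" "v extreme_point_of F" "w extreme_point_of F"
    "z extreme_point_of F"
    using ext on by auto
  show ?thesis
    using X
  proof
    assume "Q_factorial_fano X"
    then obtain k where "k simplex F"
      using F(1) unfolding Q_factorial_fano_def simplicial_def by blast
    then show ?thesis
      using simplex_no_parallelogram ext_F dist by blast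
  next
    assume "smooth_fano X"
    then have "lattice_basis {x. x extreme_point_of F}"
      using F(1) unfolding smooth_fano_def by blast
    then show ?thesis
      using lattice_basis_no_parallelogram[of _ u v w z] ext_F dist by simp
  qed
qed

lemma inner_le_convex_hull:
  assumes "\<And>v. v \<in> V \<Longrightarrow> a \<bullet> v \<le> 1" and "x \<in> convex hull V"
  shows "a \<bullet> x \<le> (1 :: real)"
proof -
  have "convex hull V \<subseteq> {x. a \<bullet> x \<le> 1}"
    using assms(1) by (intro hull_minimal convex_halfspace_le) auto
  then show ?thesis
    using assms(2) by auto
qed

text \<open>
  The sign \<open>\<epsilon>\<close> treats the cliques of $G$ and, with \<open>\<epsilon> = -1\<close>, those of $H$. The two
  parallelograms are $e_a + e_{abc} = e_{ab} + e_{ac}$ on the hyperplane $x_a = 1$ if $b, c$ are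
  adjacent, and $e_b + e_{ac} = e_c + e_{ab}$ on $x_b + x_c = 1$ otherwise.
\<close>

lemma edge_unique_same_graph:
  fixes V :: "(real^'n::finite) set"
  assumes X: "Q_factorial_fano (convex hull V) \<or> smooth_fano (convex hull V)"
    and V: "\<And>v. v \<in> V \<Longrightarrow>
      (\<exists>S. pairwise G S \<and> v = \<epsilon> *\<^sub>R indicator_vec S) \<or> (\<exists>S. v = - \<epsilon> *\<^sub>R indicator_vec S)"
    and ext: "\<And>S. pairwise G S \<Longrightarrow> S \<noteq> {} \<Longrightarrow> (\<epsilon> *\<^sub>R indicator_vec S) extreme_point_of convex hull V"
    and eps: "\<epsilon> * \<epsilon> = 1" and sym: "symp G" and "irreflp G" and ab: "G a b" and ac: "G a c"
  shows "b = c"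
proof (rule ccontr)
  assume "b \<noteq> c"
  have ne: "a \<noteq> b" "a \<noteq> c"
    using ab ac assms(6) by (auto simp: irreflp_def)
  have cl: "pairwise G {b}" "pairwise G {c}" "pairwise G {a}" "pairwise G {a, b}" "pairwise G {a, c}"
    using ab ac sym by (auto simp: pairwise_def symp_def)
  have "\<epsilon> \<noteq> 0"
    using eps by auto
  \<comment> \<open>Scaling the functional and the points by \<open>\<epsilon>\<close> reduces both
    signs to one, since \<open>\<epsilon> * \<epsilon> = 1\<close>. Nonnegativity of
    \<open>d\<close> on indicators keeps all generators of the opposite sign at values at most 0,
    whatever the other graph is.\<close>
  have par: "indicator_vec S + indicator_vec T \<noteq> (indicator_vec S' + indicator_vec T' :: real^'n)"
    if le: "\<And>S. pairwise G S \<Longrightarrow> d \<bullet> indicator_vec S \<le> 1" and nonneg: "\<And>S. d \<bullet> indicator_vec S \<ge> 0"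
      and S: "pairwise G S" "pairwise G T" "pairwise G S'" "pairwise G T'"
      and on: "d \<bullet> indicator_vec S = 1" "d \<bullet> indicator_vec T = 1" "d \<bullet> indicator_vec S' = 1"
        "d \<bullet> indicator_vec T' = 1"
      and dist: "distinct [S, S', T', T]"
    for d S T S' T'
  proof -
    have "(\<epsilon> *\<^sub>R d) \<bullet> v \<le> 1" if "v \<in> V" for v
      using V[OF that]
    proof (elim disjE exE conjE)
      fix S assume "pairwise G S" "v = \<epsilon> *\<^sub>R indicator_vec S"
      then show ?thesis
        using le[of S] eps by (simp flip: mult.assoc)
    next
      fix S assume "v = - \<epsilon> *\<^sub>R indicator_vec S"
      then show ?thesis
        using nonneg[of S] eps by (simp flip: mult.assoc)
    qed
    then have "(\<epsilon> *\<^sub>R d) \<bullet> x \<le> 1" if "x \<in> convex hull V" for x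
      using that by (rule inner_le_convex_hull)
    moreover have "(\<epsilon> *\<^sub>R indicator_vec A) extreme_point_of convex hull V \<and>
        (\<epsilon> *\<^sub>R d) \<bullet> (\<epsilon> *\<^sub>R indicator_vec A) = 1"
      if "pairwise G A" "d \<bullet> indicator_vec A = 1" for A
      using that eps by (intro conjI ext) auto
    ultimately have "\<epsilon> *\<^sub>R indicator_vec S + \<epsilon> *\<^sub>R indicator_vec T \<noteq>
        \<epsilon> *\<^sub>R indicator_vec S' + \<epsilon> *\<^sub>R indicator_vec T'"
      using S on dist \<open>\<epsilon> \<noteq> 0\<close>
      by (intro supporting_face_no_parallelogram[OF X, of "\<epsilon> *\<^sub>R d"]) auto
    then show ?thesis
      by (metis scaleR_add_right)
  qed
  show False
  proof (cases "G b c")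
    case True
    have tri: "pairwise G {a, b, c}"
      using True ab ac sym by (auto simp: pairwise_def symp_def)
    have "indicator_vec {a} + indicator_vec {a, b, c} \<noteq>
        (indicator_vec {a, b} + indicator_vec {a, c} :: real^'n)"
      using ne \<open>b \<noteq> c\<close> by (intro par[of "axis a 1"] cl tri) (auto simp: inner_axis')
    then show False
      using ne \<open>b \<noteq> c\<close> by (auto simp: vec_eq_iff split: if_splits)
  next
    case False
    \<comment> \<open>The functional is at most 1 on cliques because no clique contains both of the
      nonadjacent elements b and c.\<close>
    have "indicator_vec {b} + indicator_vec {a, c} \<noteq>
        (indicator_vec {c} + indicator_vec {a, b} :: real^'n)"
      using ne \<open>b \<noteq> c\<close> False
      by (intro par[of "axis b 1 + axis c 1"] cl) (auto simp: inner_axis' inner_add_left pairwise_def)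
    then show False
      using ne \<open>b \<noteq> c\<close> by (auto simp: vec_eq_iff split: if_splits)
  qed
qed

text \<open>The parallelogram is (e_a + e_b) - (e_a + e_c) = e_b - e_c, on the hyperplane x_b - x_c
  = 1. The functional is at most 1 on every generator because the entries of a generator never have
  opposite signs and are at most 1 in absolute value.\<close>

lemma edge_unique_mixed:
  fixes G H :: "'n::finite \<Rightarrow> 'n \<Rightarrow> bool"
  assumes X: "Q_factorial_fano (convex hull (clique_points G H)) \<or>
      smooth_fano (convex hull (clique_points G H))"
    and "symp G" and "symp H" and "irreflp G" and "irreflp H" and ab: "G a b" and ac: "H a c"
  shows "b = c"
proof (rule ccontr)
  assume "b \<noteq> c"
  have ne: "a \<noteq> b" "a \<noteq> c"
    using ab ac assms(4,5) by (auto simp: irreflp_def)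
  have cl: "pairwise G {b}" "pairwise H {c}" "pairwise G {a, b}" "pairwise H {a, c}"
    using ab ac assms(2,3) by (auto simp: pairwise_def symp_def)
  have "(axis b 1 - axis c 1) \<bullet> x \<le> 1" if "x \<in> convex hull (clique_points G H)" for x :: "real^'n"
    using _ that
    by (rule inner_le_convex_hull) (auto simp: clique_points_def inner_axis' inner_diff_left)
  moreover have "distinct [indicator_vec {a, b}, indicator_vec {b}, - indicator_vec {c},
      - indicator_vec {a, c} :: real^'n]"
    using ne \<open>b \<noteq> c\<close> by (auto simp: vec_eq_iff split: if_splits)
  ultimately have "indicator_vec {a, b} + - indicator_vec {a, c} \<noteq>
      (indicator_vec {b} + - indicator_vec {c} :: real^'n)"
    using ne \<open>b \<noteq> c\<close>
    by (intro supporting_face_no_parallelogram[OF X, of "axis b 1 - axis c 1"] clique_extreme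
        clique_extreme_neg cl) (auto simp: inner_axis' inner_diff_left)
  then show False
    using ne \<open>b \<noteq> c\<close> by (auto simp: vec_eq_iff split: if_splits)
qed

lemma matching_if_simplicial_or_smooth:
  fixes G H :: "'n::finite \<Rightarrow> 'n \<Rightarrow> bool"
  assumes X: "Q_factorial_fano (convex hull (clique_points G H)) \<or>
      smooth_fano (convex hull (clique_points G H))"
    and sym: "symp G" "symp H" and irr: "irreflp G" "irreflp H"
    and "G a b \<or> H a b" and "G a c \<or> H a c"
  shows "b = c"
proof -
  have "b = c" if "G a b" "G a c"
    using X _ _ _ sym(1) irr(1) that
    by (rule edge_unique_same_graph[where \<epsilon> = 1]) (auto simp: clique_points_def clique_extreme[unfolded clique_points_def])
  moreover have "b = c" if "H a b" "H a c"
    using X _ _ _ sym(2) irr(2) that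
    by (rule edge_unique_same_graph[where \<epsilon> = "-1"]) (auto simp: clique_points_def clique_extreme_neg[unfolded clique_points_def])
  ultimately show ?thesis
    using edge_unique_mixed[OF X sym irr] assms(6,7) by metis
qed

section \<open>Splitting along a matching\<close>

text \<open>The scalar matrices 1 and -1 provide all the copies that are needed; the sign -1 is for
  a pentagon whose edge belongs to \<open>H\<close> alone.\<close>

lemma copy_in_relabel:
  fixes I :: "'n::finite set" and \<sigma> :: "'m::finite \<Rightarrow> 'n" and \<epsilon> :: real
  assumes "bij_betw \<sigma> UNIV I" and "\<bar>\<epsilon>\<bar> = 1" and "\<epsilon> \<in> \<int>"
  shows "\<exists>f :: real^'m \<Rightarrow> real^'n. linear f \<and> (\<forall>j. f (axis j 1) = \<epsilon> *\<^sub>R axis (\<sigma> j) 1) \<and>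
    (\<forall>V. copy_in V I (f ` V))"
proof (intro exI conjI allI)
  let ?f = "\<lambda>v. \<Sum>j\<in>UNIV. ((mat \<epsilon> :: real^'m^'m) *v v) $ j *\<^sub>R axis (\<sigma> j) 1 :: real^'n"
  show "linear ?f"
    by (rule linearI)
      (simp_all add: matrix_vector_right_distrib matrix_vector_mult_scaleR scaleR_sum_right
        sum.distrib scaleR_left_distrib)
  have mat: "(mat \<epsilon> *v v) $ j = \<epsilon> * v $ j" for v :: "real^'m" and j
    by (simp add: matrix_vector_mult_def mat_def if_distrib[of "\<lambda>c. c * _"] cong: if_cong)
  show "?f (axis j 1) = \<epsilon> *\<^sub>R axis (\<sigma> j) 1" for j
    unfolding mat by (simp add: axis_def if_distrib[of "\<lambda>c. c *\<^sub>R _"] if_distrib[of "\<lambda>c. \<epsilon> * c"] cong: if_cong)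
  have "unimodular (mat \<epsilon> :: real^'m^'m)"
    using assms(2,3) by (auto simp: unimodular_def mat_def det_diagonal power_abs)
  then show "copy_in V I (?f ` V)" for V
    unfolding copy_in_def using assms(1) by blast
qed

text \<open>The origin is the midpoint of \<open>u\<close> and \<open>- u\<close>. It has to be
  removed because the empty clique contributes it to the generators, whereas the generators of the
  three pieces do not include it.\<close>

lemma convex_hull_insert_0:
  assumes "u \<in> V" and "- u \<in> (V :: 'a::real_vector set)"
  shows "convex hull (insert 0 V) = convex hull V"
proof (rule hull_redundant)
  have "(1 / 2) *\<^sub>R u + (1 / 2) *\<^sub>R (- u) \<in> convex hull V"
    using assms by (intro convexD convex_convex_hull hull_inc) auto
  then show "0 \<in> convex hull V"
    by simp
qed

lemma clique_points_coord_space: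
  "clique_points G H \<inter> coord_space J =
     indicator_vec ` {S. S \<subseteq> J \<and> pairwise G S} \<union> (\<lambda>S. - indicator_vec S) ` {S. S \<subseteq> J \<and> pairwise H S}"
  unfolding clique_points_def by auto

lemma cliques_singleton: "{S. S \<subseteq> {i} \<and> pairwise G S} = {{}, {i}}"
  by (auto simp: subset_singleton_iff)

lemma cliques_pair:
  assumes "i \<noteq> j" and "symp G"
  shows "{S. S \<subseteq> {i, j} \<and> pairwise G S} =
    (if G i j then {{}, {i}, {j}, {i, j}} else {{}, {i}, {j}})"
proof -
  have "S \<subseteq> {i, j} \<longleftrightarrow> S = {} \<or> S = {i} \<or> S = {j} \<or> S = {i, j}" for S
    by blast
  moreover have "pairwise G {i, j} \<longleftrightarrow> G i j"
    using assms by (auto simp: pairwise_def symp_def)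
  moreover have "pairwise G {}" "pairwise G {i}" "pairwise G {j}"
    by auto
  ultimately show ?thesis
    by (cases "G i j") auto
qed

lemma copy_in_block_singleton:
  "copy_in symmetric_interval {i} (convex hull (clique_points G H \<inter> coord_space {i}))"
proof -
  have "bij_betw (\<lambda>_ :: 1. i) UNIV {i}"
    by (simp add: bij_betw_def inj_on_def UNIV_1)
  then obtain f :: "real^1 \<Rightarrow> real^'a" where f: "linear f" "f (axis 1 1) = axis i 1"
    "\<And>V. copy_in V {i} (f ` V)"
    using copy_in_relabel[of _ "{i}" 1] by fastforce
  have "f ` symmetric_interval = convex hull {axis i 1, - axis i 1}"
    using f(1,2) by (simp add: symmetric_interval_hull convex_hull_linear_image linear_neg)
  also have "\<dots> = convex hull (clique_points G H \<inter> coord_space {i})"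
    unfolding clique_points_coord_space cliques_singleton
    using convex_hull_insert_0[of "axis i 1" "{axis i 1, - axis i 1 :: real^'a}"]
    by (simp add: indicator_vec_singleton insert_commute)
  finally show ?thesis
    using f(3)[of symmetric_interval] by simp
qed

text \<open>An edge in both graphs contributes e_i + e_j and its negative, giving the hexagon. An
  edge in \<open>G\<close> alone gives the pentagon, and an edge in \<open>H\<close> alone gives the
  negated pentagon, for which \<open>g\<close> is used.\<close>

lemma copy_in_block_pair:
  assumes ne: "i \<noteq> j" and sym: "symp G" "symp H" and ij: "G i j \<or> H i j"
  defines "X \<equiv> convex hull (clique_points G H \<inter> coord_space {i, j :: 'n::finite})"
  shows "copy_in del_Pezzo {i, j} X \<or> copy_in pseudo_del_Pezzo {i, j} X"
proof -
  define \<sigma> :: "2 \<Rightarrow> 'n" where "\<sigma> = (\<lambda>x. if x = 1 then i else j)"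
  have "bij_betw \<sigma> UNIV {i, j}"
    using ne by (auto simp: bij_betw_def inj_on_def UNIV_2 \<sigma>_def)
  note rel = copy_in_relabel[OF this]
  obtain f :: "real^2 \<Rightarrow> real^'n" where f: "linear f" "f (axis 1 1) = axis i 1" "f (axis 2 1) = axis j 1"
    "\<And>V. copy_in V {i, j} (f ` V)"
    using rel[of 1] by (auto simp: \<sigma>_def)
  obtain g :: "real^2 \<Rightarrow> real^'n" where g: "linear g" "g (axis 1 1) = - axis i 1"
    "g (axis 2 1) = - axis j 1" "\<And>V. copy_in V {i, j} (g ` V)"
    using rel[of "-1"] by (auto simp: \<sigma>_def)
  note pts = clique_points_coord_space cliques_pair[OF ne sym(1)] cliques_pair[OF ne sym(2)]
  note zero = convex_hull_insert_0[of "axis i 1 :: real^'n"]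
  consider "G i j" "H i j" | "G i j" "\<not> H i j" | "\<not> G i j" "H i j"
    using ij by blast
  then show ?thesis
  proof cases
    case 1
    have "X = convex hull insert 0 {axis i 1, - axis i 1, axis j 1, - axis j 1, axis i 1 + axis j 1,
        - (axis i 1 + axis j 1)}"
      unfolding X_def pts using 1 ne
      by (intro arg_cong[where f = "\<lambda>V. convex hull V"])
        (auto simp: indicator_vec_singleton indicator_vec_pair)
    also have "\<dots> = f ` del_Pezzo"
      using f(1-3) by (subst zero)
        (simp_all add: del_Pezzo_def convex_hull_linear_image linear_neg linear_add linear_diff)
    finally show ?thesis
      using f(4)[of del_Pezzo] by simp
  next
    case 2
    have "X = convex hull insert 0 {axis i 1, - axis i 1, axis j 1, - axis j 1, axis i 1 + axis j 1}"
      unfolding X_def pts using 2 ne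
      by (intro arg_cong[where f = "\<lambda>V. convex hull V"])
        (auto simp: indicator_vec_singleton indicator_vec_pair)
    also have "\<dots> = f ` pseudo_del_Pezzo"
      using f(1-3) by (subst zero)
        (simp_all add: pseudo_del_Pezzo_def convex_hull_linear_image linear_neg linear_add)
    finally show ?thesis
      using f(4)[of pseudo_del_Pezzo] by simp
  next
    case 3
    have "X = convex hull insert 0 {- axis i 1, axis i 1, - axis j 1, axis j 1, - axis i 1 + - axis j 1}"
      unfolding X_def pts using 3 ne
      by (intro arg_cong[where f = "\<lambda>V. convex hull V"])
        (auto simp: indicator_vec_singleton indicator_vec_pair)
    also have "\<dots> = g ` pseudo_del_Pezzo"
      using g(1-3) by (subst zero)
        (simp_all add: pseudo_del_Pezzo_def convex_hull_linear_image linear_neg linear_add)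
    finally show ?thesis
      using g(4)[of pseudo_del_Pezzo] by simp
  qed
qed

text \<open>Induction that cuts off one block at a time. Closure of \<open>J\<close> under adjacency
  keeps the partner of each element inside \<open>J\<close>, and it passes to what remains after a
  block is removed.\<close>

lemma matching_splits_into:
  fixes G H :: "'n::finite \<Rightarrow> 'n \<Rightarrow> bool"
  assumes sym: "symp G" "symp H" and irr: "irreflp G" "irreflp H"
    and matching: "\<And>a b c. G a b \<or> H a b \<Longrightarrow> G a c \<or> H a c \<Longrightarrow> b = c"
    and "J \<noteq> {}" and "\<And>x y. x \<in> J \<Longrightarrow> G x y \<or> H x y \<Longrightarrow> y \<in> J"
  shows "splits_into
    (\<lambda>I X. copy_in symmetric_interval I X \<or> copy_in del_Pezzo I X \<or> copy_in pseudo_del_Pezzo I X)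
    J (convex hull (clique_points G H \<inter> coord_space J))"
  using assms(6,7)
proof (induction "card J" arbitrary: J rule: less_induct)
  case less
  let ?K = "\<lambda>I X. copy_in symmetric_interval I X \<or> copy_in del_Pezzo I X \<or> copy_in pseudo_del_Pezzo I X"
  let ?X = "\<lambda>J. convex hull (clique_points G H \<inter> coord_space J)"
  define E where "E x y \<longleftrightarrow> G x y \<or> H x y" for x y
  have E_sym: "E x y \<Longrightarrow> E y x" for x y
    using sym by (auto simp: E_def symp_def)
  have E_matching: "E a b \<Longrightarrow> E a c \<Longrightarrow> b = c" for a b c
    using matching by (auto simp: E_def)
  obtain i where i: "i \<in> J"
    using less.prems(1) by blast
  \<comment> \<open>This is the connected component of i, since i has at most one neighbour.\<close>
  define B where "B = insert i {y. E i y}"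
  have B_closed: "y \<in> B" if "x \<in> B" "E x y" for x y
    using that E_sym E_matching unfolding B_def by blast
  have B: "B \<subseteq> J" "i \<in> B"
    using i less.prems(2) by (auto simp: B_def E_def)
  have block: "splits_into ?K B (?X B)"
  proof (rule splits_into.piece[OF fano_in_clique_points])
    show "?K B (?X B)"
    proof (cases "\<exists>j. E i j")
      case True
      then obtain j where "E i j"
        by blast
      moreover from this have "B = {i, j}" "i \<noteq> j"
        using E_matching irr by (auto simp: B_def E_def irreflp_def)
      ultimately show ?thesis
        using copy_in_block_pair[of i j G H] sym by (auto simp: E_def)
    next
      case False
      then have "B = {i}"
        by (auto simp: B_def)
      then show ?thesis
        using copy_in_block_singleton by auto
    qed
  qed
  show ?case
  proof (cases "B = J")
    case True
    then show ?thesis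
      using block by simp
  next
    case False
    have rest: "splits_into ?K (J - B) (?X (J - B))"
    proof (rule less.hyps)
      show "card (J - B) < card J"
        using B i by (intro psubset_card_mono) auto
      show "J - B \<noteq> {}"
        using False B by blast
      fix x y assume x: "x \<in> J - B" and "G x y \<or> H x y"
      then have "E x y"
        by (simp add: E_def)
      then have "y \<notin> B"
        using x B_closed E_sym by blast
      then show "y \<in> J - B"
        using x less.prems(2) \<open>G x y \<or> H x y\<close> by blast
    qed
    \<comment> \<open>All elements of a clique are adjacent to any one of them, and adjacency does
      not lead out of \<open>B\<close>.\<close>
    have clique: "S \<subseteq> B \<or> S \<subseteq> J - B" if "S \<subseteq> J" "pairwise R S" "\<And>x y. R x y \<Longrightarrow> E x y" for S R
    proof (cases "S \<inter> B = {}")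
      case False
      then obtain x where x: "x \<in> S" "x \<in> B"
        by blast
      have "y \<in> B" if "y \<in> S" for y
        using x that B_closed[of x y] \<open>pairwise R S\<close> \<open>\<And>x y. R x y \<Longrightarrow> E x y\<close>
        by (cases "x = y") (auto simp: pairwise_def)
      then show ?thesis
        by blast
    qed (use that(1) in blast)
    have cliques: "{S. S \<subseteq> J \<and> pairwise R S} = {S. S \<subseteq> B \<and> pairwise R S} \<union> {S. S \<subseteq> J - B \<and> pairwise R S}"
      if "\<And>x y. R x y \<Longrightarrow> E x y" for R
      using clique[OF _ _ that] B(1) by blast
    have *: "{S. S \<subseteq> J \<and> pairwise G S} = {S. S \<subseteq> B \<and> pairwise G S} \<union> {S. S \<subseteq> J - B \<and> pairwise G S}"
      "{S. S \<subseteq> J \<and> pairwise H S} = {S. S \<subseteq> B \<and> pairwise H S} \<union> {S. S \<subseteq> J - B \<and> pairwise H S}"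
      by (intro cliques; simp add: E_def)+
    have "clique_points G H \<inter> coord_space J =
        (clique_points G H \<inter> coord_space B) \<union> (clique_points G H \<inter> coord_space (J - B))"
      by (simp only: clique_points_coord_space * image_Un Un_ac)
    then have "?X J = convex hull (?X B \<union> ?X (J - B))"
      by (simp only:) (intro hull_Un, simp add: convex_Inter)
    then have "splits J (?X J) B (?X B) (J - B) (?X (J - B))"
      using B False unfolding splits_def by (intro conjI fano_in_clique_points) blast+
    then show ?thesis
      using block rest by (rule splits_into.split)
  qed
qed

section \<open>Posets and incomparability graphs\<close>

definition incomparable :: "'a rel \<Rightarrow> ('n \<Rightarrow> 'a) \<Rightarrow> 'n \<Rightarrow> 'n \<Rightarrow> bool" where
  "incomparable r p i j \<longleftrightarrow> (p i, p j) \<notin> r \<and> (p j, p i) \<notin> r"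

lemma symp_incomparable: "symp (incomparable r p)"
  by (auto simp: symp_def incomparable_def)

lemma irreflp_incomparable:
  assumes "partial_order_on P r" and "bij_betw p UNIV P"
  shows "irreflp (incomparable r p)"
  using assms by (auto simp: irreflp_def incomparable_def partial_order_on_def preorder_on_def
      refl_on_def bij_betw_def)

lemma antichain_image:
  assumes "bij_betw p UNIV P"
  shows "antichain P r (p ` S) \<longleftrightarrow> pairwise (incomparable r p) S"
  using assms unfolding antichain_def pairwise_def incomparable_def bij_betw_def
  by (auto simp: inj_eq)

lemma antichains_eq_cliques:
  assumes "bij_betw p UNIV P"
  shows "{A. antichain P r A} = (\<lambda>S. p ` S) ` {S. pairwise (incomparable r p) S}"
proof -
  have "A \<in> (`) p ` {S. pairwise (incomparable r p) S}" if A: "antichain P r A" for A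
  proof (rule image_eqI)
    show "A = p ` (p -` A)"
      using A assms by (auto simp: antichain_def bij_betw_def)
    then show "p -` A \<in> {S. pairwise (incomparable r p) S}"
      using A antichain_image[OF assms, of r "p -` A"] by simp
  qed
  then show ?thesis
    using antichain_image[OF assms, of r] by auto
qed

lemma rho_image: "inj p \<Longrightarrow> rho p (p ` S) = indicator_vec S"
  by (simp add: rho_def vec_eq_iff axis_def inj_image_mem_iff sum.If_cases)

lemma Gamma_polytope_clique_points:
  assumes "bij_betw p UNIV P" and "bij_betw q UNIV Q"
  shows "Gamma_polytope P r p Q s q =
    convex hull (clique_points (incomparable r p) (incomparable s q))"
proof -
  have "inj p" "inj q"
    using assms by (auto simp: bij_betw_def)
  then show ?thesis
    unfolding Gamma_polytope_def clique_points_def setcompr_eq_image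
    by (simp add: antichains_eq_cliques[OF assms(1)] antichains_eq_cliques[OF assms(2)] image_image rho_image)
qed

lemma disjoint_antichains_iff_matching:
  assumes "bij_betw p UNIV P" and "irreflp (incomparable r p)"
  shows "(\<forall>A A'. antichain P r A \<and> card A = 2 \<and> antichain P r A' \<and> card A' = 2 \<and> A \<noteq> A'
            \<longrightarrow> A \<inter> A' = {}) \<longleftrightarrow>
    (\<forall>a b c. incomparable r p a b \<and> incomparable r p a c \<longrightarrow> b = c)" (is "?L \<longleftrightarrow> ?R")
proof
  have inj: "inj p"
    using assms(1) by (auto simp: bij_betw_def)
  assume L: ?L
  show ?R
  proof (intro allI impI, elim conjE, rule ccontr)
    fix a b c assume ab: "incomparable r p a b" and ac: "incomparable r p a c" and "b \<noteq> c"
    have ne: "a \<noteq> b" "a \<noteq> c"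
      using ab ac assms(2) by (auto simp: irreflp_def)
    have "antichain P r (p ` {a, b})" "antichain P r (p ` {a, c})"
      unfolding antichain_image[OF assms(1)] using ab ac symp_incomparable[of r p]
      by (auto simp: pairwise_def symp_def)
    moreover have "card (p ` {a, b}) = 2" "card (p ` {a, c}) = 2"
      using ne inj by (simp_all add: card_image inj_on_subset inj_eq)
    moreover have "p ` {a, b} \<noteq> p ` {a, c}"
      using ne \<open>b \<noteq> c\<close> by (auto simp: doubleton_eq_iff inj_eq[OF inj])
    ultimately show False
      using L by blast
  qed
next
  assume R: ?R
  \<comment> \<open>Any chosen element can be listed first, so two antichains that meet become two
    edges at the same vertex.\<close>
  have part: "\<exists>i j. A = {p i, p j} \<and> x = p i \<and> incomparable r p i j"
    if A: "antichain P r A" "card A = 2" "x \<in> A" for A x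
  proof -
    have "card (A - {x}) = 1"
      using A(2,3) by simp
    then obtain y where "A - {x} = {y}"
      by (rule card_1_singletonE)
    then have y: "A = {x, y}" "x \<noteq> y"
      using A(3) by blast+
    then have "x \<in> range p" "y \<in> range p"
      using A(1) assms(1) by (simp_all add: antichain_def bij_betw_def)
    then obtain i j where ij: "x = p i" "y = p j"
      by blast
    then have "incomparable r p i j"
      using A(1) y by (simp add: antichain_def incomparable_def)
    then show ?thesis
      using y(1) ij by blast
  qed
  show ?L
  proof (intro allI impI, elim conjE, rule ccontr)
    fix A A' assume A: "antichain P r A" "card A = 2" "antichain P r A'" "card A' = 2" "A \<noteq> A'"
      and "A \<inter> A' \<noteq> {}"
    then obtain x where "x \<in> A" "x \<in> A'"
      by blast
    obtain i j where ij: "A = {p i, p j}" "x = p i" "incomparable r p i j"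
      using part[OF A(1,2) \<open>x \<in> A\<close>] by (elim exE conjE)
    obtain i' j' where ij': "A' = {p i', p j'}" "x = p i'" "incomparable r p i' j'"
      using part[OF A(3,4) \<open>x \<in> A'\<close>] by (elim exE conjE)
    have "i = i'"
      using assms(1) ij(2) ij'(2) by (simp add: bij_betw_def inj_eq)
    moreover from this have "j = j'"
      using R ij(3) ij'(3) by blast
    ultimately show False
      using ij(1) ij'(1) A(5) by simp
  qed
qed

lemma mixed_antichains_iff_matching:
  assumes p: "bij_betw p UNIV P" "irreflp (incomparable r p)"
    and q: "bij_betw q UNIV Q" "irreflp (incomparable s q)"
  shows "(\<forall>a b c e. a \<noteq> b \<and> antichain P r {p a, p b} \<and> c \<noteq> e \<and> antichain Q s {q c, q e}
            \<longrightarrow> card ({a, b} \<inter> {c, e}) \<noteq> 1) \<longleftrightarrow>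
    (\<forall>a b c. incomparable r p a b \<and> incomparable s q a c \<longrightarrow> b = c)" (is "?L \<longleftrightarrow> ?R")
proof -
  have P: "a \<noteq> b \<and> antichain P r {p a, p b} \<longleftrightarrow> incomparable r p a b" for a b
    using antichain_image[OF p(1), of r "{a, b}"] p(2) symp_incomparable[of r p]
    by (auto simp: pairwise_def irreflp_def symp_def)
  have Q: "a \<noteq> b \<and> antichain Q s {q a, q b} \<longleftrightarrow> incomparable s q a b" for a b
    using antichain_image[OF q(1), of s "{a, b}"] q(2) symp_incomparable[of s q]
    by (auto simp: pairwise_def irreflp_def symp_def)
  have "?L \<longleftrightarrow> (\<forall>a b c e. incomparable r p a b \<and> incomparable s q c e \<longrightarrow> card ({a, b} \<inter> {c, e}) \<noteq> 1)"
    unfolding P[symmetric] Q[symmetric] by simp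
  also have "\<dots> \<longleftrightarrow> ?R"
  proof
    assume L: "\<forall>a b c e. incomparable r p a b \<and> incomparable s q c e \<longrightarrow> card ({a, b} \<inter> {c, e}) \<noteq> 1"
    show ?R
    proof (intro allI impI, elim conjE, rule ccontr)
      fix a b c assume ab: "incomparable r p a b" and ac: "incomparable s q a c" and "b \<noteq> c"
      have "a \<noteq> b" "a \<noteq> c"
        using ab ac p(2) q(2) by (auto simp: irreflp_def)
      then have eq: "{a, b} \<inter> {a, c} = {a}"
        using \<open>b \<noteq> c\<close> by auto
      have "card ({a, b} \<inter> {a, c}) = 1"
        unfolding eq by simp
      then show False
        using L ab ac by blast
    qed
  next
    assume R: ?R
    show "\<forall>a b c e. incomparable r p a b \<and> incomparable s q c e \<longrightarrow> card ({a, b} \<inter> {c, e}) \<noteq> 1"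
    proof (intro allI impI, elim conjE, rule notI)
      fix a b c e assume ab: "incomparable r p a b" and ce: "incomparable s q c e"
        and 1: "card ({a, b} \<inter> {c, e}) = 1"
      have "incomparable r p b a" "incomparable s q e c" "a \<noteq> b" "c \<noteq> e"
        using ab ce p(2) q(2) by (auto simp: irreflp_def incomparable_def)
      \<comment> \<open>One common endpoint forces the other endpoints to agree, so the two pairs
        are equal or disjoint and never meet in exactly one index.\<close>
      then have "a = c \<Longrightarrow> b = e" "a = e \<Longrightarrow> b = c" "b = c \<Longrightarrow> a = e" "b = e \<Longrightarrow> a = c"
        using R ab ce by auto
      then have "{a, b} \<inter> {c, e} = {a, b} \<or> {a, b} \<inter> {c, e} = {}"
        by blast
      then show False
        using 1 \<open>a \<noteq> b\<close> by (elim disjE) simp_all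
    qed
  qed
  finally show ?thesis .
qed

theorem theorem2p1:
  fixes P :: "'a set" and r :: "'a rel" and p :: "'n::finite \<Rightarrow> 'a"
    and Q :: "'b set" and s :: "'b rel" and q :: "'n \<Rightarrow> 'b"
  assumes "CARD('n) \<ge> 2"
    and "partial_order_on P r" and "bij_betw p UNIV P"
    and "partial_order_on Q s" and "bij_betw q UNIV Q"
  shows
    "(Q_factorial_fano (Gamma_polytope P r p Q s q) \<longleftrightarrow> smooth_fano (Gamma_polytope P r p Q s q)) \<and>
     (smooth_fano (Gamma_polytope P r p Q s q) \<longleftrightarrow>
        splits_into
          (\<lambda>I X. copy_in symmetric_interval I X \<or> copy_in del_Pezzo I X \<or> copy_in pseudo_del_Pezzo I X)
          UNIV (Gamma_polytope P r p Q s q)) \<and>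
     (splits_into
          (\<lambda>I X. copy_in symmetric_interval I X \<or> copy_in del_Pezzo I X \<or> copy_in pseudo_del_Pezzo I X)
          UNIV (Gamma_polytope P r p Q s q) \<longleftrightarrow>
        (\<forall>A A'. antichain P r A \<and> card A = 2 \<and> antichain P r A' \<and> card A' = 2 \<and> A \<noteq> A'
            \<longrightarrow> A \<inter> A' = {}) \<and>
        (\<forall>B B'. antichain Q s B \<and> card B = 2 \<and> antichain Q s B' \<and> card B' = 2 \<and> B \<noteq> B'
            \<longrightarrow> B \<inter> B' = {}) \<and>
        (\<forall>a b c e. a \<noteq> b \<and> antichain P r {p a, p b} \<and> c \<noteq> e \<and> antichain Q s {q c, q e}
            \<longrightarrow> card ({a, b} \<inter> {c, e}) \<noteq> 1))"
proof -
  let ?G = "incomparable r p" and ?H = "incomparable s q"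
  let ?X = "Gamma_polytope P r p Q s q"
  let ?S = "splits_into
    (\<lambda>I X. copy_in symmetric_interval I X \<or> copy_in del_Pezzo I X \<or> copy_in pseudo_del_Pezzo I X)
    UNIV ?X"
  let ?M = "\<forall>a b c. (?G a b \<or> ?H a b) \<and> (?G a c \<or> ?H a c) \<longrightarrow> b = c"
  note irr = irreflp_incomparable[OF assms(2,3)] irreflp_incomparable[OF assms(4,5)]
  note sym = symp_incomparable[of r p] symp_incomparable[of s q]
  have X: "?X = convex hull (clique_points ?G ?H)"
    by (rule Gamma_polytope_clique_points[OF assms(3,5)])
  have "coord_space UNIV = (UNIV :: (real^'n) set)"
    by (simp add: coord_space_def)
  then have "?M \<Longrightarrow> ?S"
    using matching_splits_into[OF sym irr, of UNIV] unfolding X by simp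
  moreover have "Q_factorial_fano ?X" "smooth_fano ?X" if S: ?S
    using splits_into_fano[OF S] splits_into_unimodular_hull[OF S]
    by (rule unimodular_hull_Q_factorial, rule unimodular_hull_smooth)
  moreover have ?M if "Q_factorial_fano ?X \<or> smooth_fano ?X"
    using matching_if_simplicial_or_smooth[OF that[unfolded X] sym irr] by blast
  \<comment> \<open>The three conjuncts match the three clauses of (iv). The remaining mixed case,
    with the edge of \<open>H\<close> first, is the last conjunct with b and c exchanged.\<close>
  moreover have "?M \<longleftrightarrow> (\<forall>a b c. ?G a b \<and> ?G a c \<longrightarrow> b = c) \<and> (\<forall>a b c. ?H a b \<and> ?H a c \<longrightarrow> b = c) \<and>
      (\<forall>a b c. ?G a b \<and> ?H a c \<longrightarrow> b = c)"
    by (rule iffI; blast)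
  ultimately show ?thesis
    unfolding disjoint_antichains_iff_matching[OF assms(3) irr(1)]
      disjoint_antichains_iff_matching[OF assms(5) irr(2)]
      mixed_antichains_iff_matching[OF assms(3) irr(1) assms(5) irr(2)]
    by argo
qed

end
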